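(* There exists an absolute constant $c>0$ such that, for any finite set $A \subset \mathbb{R}$, \[ \max \{ |16A|, |A^{(16)}| \} \geq |A|^{\frac{3}{2}+c}. \]
   Context: For a finite set $A \subset \mathbb{R}$ and $k \in \mathbb{N}$, the $k$-fold sum set and $k$-fold product set are \[ kA := \{a_1+\dots+a_k : a_1,\dots,a_k \in A\}, \qquad A^{(k)} := \{a_1 \cdots a_k : a_1,\dots,a_k \in A\}. \] $|\cdot|$ denotes cardinality of a finite set. *)

theory Defs
  imports Complex_Main
begin

definition sumset :: "nat \<Rightarrow> real set \<Rightarrow> real set" where
  "sumset k A = {(\<Sum>i<k. a i) | a. \<forall>i<k. a i \<in> A}"

definition prodset :: "nat \<Rightarrow> real set \<Rightarrow> real set" where
  "prodset k A = {(\<Prod>i<k. a i) | a. \<forall>i<k. a i \<in> A}"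

end

theory Submission
  imports Defs
begin

text \<open>Let \<open>X\<close> be a finite set of positive reals with \<open>m\<close> gaps \<open>d\<^sub>i\<close>, and let \<open>e\<^sub>i\<close> be the gaps of \<open>ln X\<close>.
  The pair \<open>(d\<^sub>i, e\<^sub>i)\<close> determines \<open>i\<close>. Counting short steps in the grid formed by the \<open>j\<close>-fold sums and the
  \<open>j\<close>-fold sums of logarithms gives \<open>p\<^sub>j\<^sub>+\<^sub>1\<^sup>2 \<ge> (2/9) m\<^sup>3 p\<^sub>j\<close> for the product \<open>p\<^sub>j\<close> of the numbers of
  sums and of products, so that \<open>p\<^sub>1\<^sub>6\<close> is almost \<open>m\<^sup>3\<close>.

  If \<open>p\<^sub>1\<^sub>6\<close> is not much larger than \<open>m\<^sup>3\<close>, then all the inequalities are nearly sharp. About \<open>m\<^sup>1\<^sup>/\<^sup>2\<close> elements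
  share the same logarithmic gap, and they form a dilate of a set of gaps of \<open>X\<close>. By Ruzsa's triangle
  inequality all the local differences of \<open>3X\<close> number only about \<open>m\<^sup>1\<^sup>/\<^sup>2\<close>, so these elements have small
  additive doubling. Since \<open>ln\<close> has strictly monotone derivatives of all orders, taking differences three
  times shows that the quotients of their 8-fold by their 7-fold products number about \<open>m\<^sup>2\<close>, against
  an upper bound of about \<open>m\<^sup>3\<^sup>/\<^sup>2\<close>.

  This contradiction needs a set of size at least \<open>2\<^sup>4\<^sup>9\<^sup>8\<close>. For smaller sets the exponent \<open>3/2\<close> is
  exceeded because the constants in the inequalities for \<open>p\<^sub>j\<close> improve when several
  summands are moved at once, and below 250 elements it suffices that \<open>16A\<close> has at least
  \<open>16 (card A - 1)\<close> elements.\<close>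

section \<open>Counting lemmas\<close>

text \<open>A right-endpoint Riemann sum with spacing \<open>1 / \<mu>\<close> of a nonincreasing
  function stays below its integral. The comparison telescopes: each term is at most a multiple of a
  difference of consecutive squares, respectively cubes.\<close>

lemma sum_pos_part_le:
  fixes c \<mu> :: real
  assumes "\<mu> > 0"
  shows "(\<Sum>g=1..G. max 0 (c - real g / \<mu>)) \<le> \<mu> / 2 * (max 0 c)^2"
    and "(\<Sum>g=1..G. (max 0 (c - real g / \<mu>))^2) \<le> \<mu> / 3 * (max 0 c)^3"
proof -
  define a where "a g = max 0 (c - real g / \<mu>)" for g :: nat
  have step: "a (Suc g) \<le> \<mu> / 2 * ((a g)^2 - (a (Suc g))^2)
      \<and> (a (Suc g))^2 \<le> \<mu> / 3 * ((a g)^3 - (a (Suc g))^3)" for g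
  proof (cases "a (Suc g) = 0")
    case True
    have "a g \<ge> 0" by (simp add: a_def)
    then show ?thesis using True assms by simp
  next
    case False
    then have pos: "a (Suc g) > 0" and eq: "a (Suc g) = c - real (Suc g) / \<mu>"
      by (auto simp: a_def max_def split: if_splits)
    have eq2: "a g = a (Suc g) + 1 / \<mu>"
      using pos eq assms by (auto simp: a_def max_def field_simps split: if_splits)
    define t where "t = 1 / \<mu>"
    have t: "t > 0" "\<mu> * t = 1" using assms by (auto simp: t_def)
    have "\<mu> / 2 * ((a g)^2 - (a (Suc g))^2) = (\<mu> * t) * (a (Suc g) + t / 2)"
      unfolding eq2 t_def[symmetric] by (simp add: power2_eq_square algebra_simps)
    moreover have "\<mu> / 3 * ((a g)^3 - (a (Suc g))^3) = (\<mu> * t) * ((a (Suc g))^2 + a (Suc g) * t + t^2 / 3)"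
      unfolding eq2 t_def[symmetric] by (simp add: power2_eq_square power3_eq_cube algebra_simps)
    ultimately show ?thesis using t pos by auto
  qed
  have "(\<Sum>g=1..G. a g) \<le> \<mu> / 2 * ((a 0)^2 - (a G)^2)"
  proof (induction G)
    case (Suc G)
    then show ?case using step[of G] by (auto simp: algebra_simps)
  qed simp
  moreover have "\<mu> * (a G)^2 \<ge> 0" "\<mu> * (a G)^3 \<ge> 0" using assms by (auto simp: a_def)
  moreover have "(\<Sum>g=1..G. (a g)^2) \<le> \<mu> / 3 * ((a 0)^3 - (a G)^3)"
  proof (induction G)
    case (Suc G)
    then show ?case using step[of G] by (auto simp: algebra_simps)
  qed simp
  ultimately show "(\<Sum>g=1..G. max 0 (c - real g / \<mu>)) \<le> \<mu> / 2 * (max 0 c)^2"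
    "(\<Sum>g=1..G. (max 0 (c - real g / \<mu>))^2) \<le> \<mu> / 3 * (max 0 c)^3"
    by (auto simp: a_def algebra_simps)
qed

text \<open>The mean of \<open>u i / \<mu> + v i / \<nu>\<close> is 2 when \<open>\<mu>\<close> and \<open>\<nu>\<close> are the means of \<open>u\<close> and \<open>v\<close>, so
  the sum of \<open>3 - u i / \<mu> - v i / \<nu>\<close> is \<open>card I\<close>. The sum of the positive part over the lattice is at
  most its integral.\<close>

lemma card_cube_le_of_fibres:
  fixes u v :: "'a \<Rightarrow> nat"
  assumes fin: "finite I"
    and u: "\<And>i. i \<in> I \<Longrightarrow> 1 \<le> u i" and v: "\<And>i. i \<in> I \<Longrightarrow> 1 \<le> v i"
    and fib: "\<And>g h. card {i \<in> I. u i = g \<and> v i = h} \<le> M"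
  shows "2 * card I ^ 3 \<le> 9 * M * sum u I * sum v I"
proof (cases "I = {}")
  case False
  define n where "n = real (card I)"
  have n: "n > 0" using False fin by (auto simp: n_def card_gt_0_iff)
  have "sum u I \<ge> card I" "sum v I \<ge> card I"
    using sum_mono[of I "\<lambda>_. 1" u] sum_mono[of I "\<lambda>_. 1" v] u v by auto
  then have UV: "sum u I > 0" "sum v I > 0" using n by (auto simp: n_def)
  define \<mu> where "\<mu> = real (sum u I) / n"
  define \<nu> where "\<nu> = real (sum v I) / n"
  have pos: "\<mu> > 0" "\<nu> > 0" using UV n by (auto simp: \<mu>_def \<nu>_def simp del: of_nat_sum)
  \<comment> \<open>A threshold \<open>t > 2\<close> in place of 3 would lead to the factor
    \<open>t^3 / (6 * (t - 2))\<close>, which is least at \<open>t = 3\<close>, where it equals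
    9/2.\<close>
  define \<phi> where "\<phi> g h = max 0 (3 - real h / \<nu> - real g / \<mu>)" for g h :: nat
  define G where "G = Max (u ` I \<union> v ` I)"
  have G: "u i \<le> G" "v i \<le> G" if "i \<in> I" for i
    unfolding G_def using that fin by (auto intro: Max_ge)
  have "(\<Sum>i\<in>I. real (u i) / \<mu>) = real (sum u I) / \<mu>" "(\<Sum>i\<in>I. real (v i) / \<nu>) = real (sum v I) / \<nu>"
    by (simp_all add: sum_divide_distrib)
  then have "(\<Sum>i\<in>I. real (u i) / \<mu>) = n" "(\<Sum>i\<in>I. real (v i) / \<nu>) = n"
    using n UV by (simp_all add: \<mu>_def \<nu>_def del: of_nat_sum)
  then have "n = (\<Sum>i\<in>I. 3 - real (v i) / \<nu> - real (u i) / \<mu>)"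
    by (simp add: sum_subtractf n_def)
  also have "\<dots> \<le> (\<Sum>i\<in>I. \<phi> (u i) (v i))" by (intro sum_mono) (auto simp: \<phi>_def)
  also have "\<dots> = (\<Sum>q\<in>{1..G}\<times>{1..G}. \<Sum>i\<in>{i\<in>I. (u i, v i) = q}. \<phi> (u i) (v i))"
    by (rule sum.group[symmetric]) (use fin u v G in auto)
  also have "\<dots> = (\<Sum>q\<in>{1..G}\<times>{1..G}. card {i\<in>I. (u i, v i) = q} * \<phi> (fst q) (snd q))"
  proof (intro sum.cong refl)
    fix q
    have "(\<Sum>i\<in>{i\<in>I. (u i, v i) = q}. \<phi> (u i) (v i)) = (\<Sum>i\<in>{i\<in>I. (u i, v i) = q}. \<phi> (fst q) (snd q))"
      by (intro sum.cong) auto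
    then show "(\<Sum>i\<in>{i\<in>I. (u i, v i) = q}. \<phi> (u i) (v i)) = card {i\<in>I. (u i, v i) = q} * \<phi> (fst q) (snd q)"
      by simp
  qed
  also have "\<dots> \<le> (\<Sum>q\<in>{1..G}\<times>{1..G}. M * \<phi> (fst q) (snd q))"
  proof (intro sum_mono mult_right_mono)
    fix q
    show "real (card {i\<in>I. (u i, v i) = q}) \<le> real M"
      using fib[of "fst q" "snd q"] by (cases q) auto
  qed (auto simp: \<phi>_def)
  also have "\<dots> = M * (\<Sum>h=1..G. \<Sum>g=1..G. \<phi> g h)"
    by (subst sum.swap) (simp add: sum.cartesian_product sum_distrib_left split_beta)
  also have "\<dots> \<le> M * (\<Sum>h=1..G. \<mu> / 2 * (max 0 (3 - real h / \<nu>))^2)"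
    unfolding \<phi>_def by (intro mult_left_mono sum_mono sum_pos_part_le(1) pos) auto
  also have "\<dots> = M * (\<mu> / 2 * (\<Sum>h=1..G. (max 0 (3 - real h / \<nu>))^2))"
    by (simp add: sum_distrib_left)
  also have "\<dots> \<le> M * (\<mu> / 2 * (\<nu> / 3 * (max 0 3)^3))"
    by (intro mult_left_mono sum_pos_part_le(2) pos) (use pos in auto)
  also have "\<dots> = 9 / 2 * M * real (sum u I) * real (sum v I) / n^2"
    by (simp add: \<mu>_def \<nu>_def power2_eq_square)
  finally have "2 * n^3 \<le> 9 * M * real (sum u I) * real (sum v I)"
    using n by (simp add: field_simps power2_eq_square power3_eq_cube del: of_nat_sum)
  then have "real (2 * card I ^ 3) \<le> real (9 * M * sum u I * sum v I)"
    by (simp add: n_def)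
  then show ?thesis by (simp only: of_nat_le_iff)
qed simp

text \<open>With \<open>r\<close> the largest multiplicity, the indices with value at most
  \<open>e i\<close> number at most \<open>r\<close> times the rank of \<open>e i\<close>. Any two
  indices are comparable in some direction, so these numbers sum to at least half of
  \<open>card H ^ 2\<close>.\<close>

lemma popular_value:
  fixes e :: "'a \<Rightarrow> real"
  assumes fin: "finite H"
    and V: "(\<Sum>i\<in>H. card {\<epsilon> \<in> e ` H. \<epsilon> \<le> e i}) \<le> V"
  shows "\<exists>\<epsilon>. card H ^ 2 \<le> 2 * V * card {i \<in> H. e i = \<epsilon>}"
proof (cases "H = {}")
  case False
  define r where "r = Max ((\<lambda>\<epsilon>. card {i \<in> H. e i = \<epsilon>}) ` e ` H)"
  have "r \<in> (\<lambda>\<epsilon>. card {i \<in> H. e i = \<epsilon>}) ` e ` H"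
    unfolding r_def using False fin by (intro Max_in) auto
  then obtain \<epsilon> where \<epsilon>: "r = card {i \<in> H. e i = \<epsilon>}" by auto
  have r: "card {i \<in> H. e i = \<epsilon>} \<le> r" if "\<epsilon> \<in> e ` H" for \<epsilon>
    unfolding r_def using that fin by (intro Max_ge) auto
  have le: "card {j \<in> H. e j \<le> e i} \<le> card {\<epsilon> \<in> e ` H. \<epsilon> \<le> e i} * r" if "i \<in> H" for i
  proof -
    have "{j \<in> H. e j \<le> e i} = (\<Union>\<epsilon>\<in>{\<epsilon> \<in> e ` H. \<epsilon> \<le> e i}. {j \<in> H. e j = \<epsilon>})" by auto
    then have "card {j \<in> H. e j \<le> e i} \<le> (\<Sum>\<epsilon>\<in>{\<epsilon> \<in> e ` H. \<epsilon> \<le> e i}. card {j \<in> H. e j = \<epsilon>})"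
      using fin by (simp add: card_UN_le)
    also have "\<dots> \<le> (\<Sum>\<epsilon>\<in>{\<epsilon> \<in> e ` H. \<epsilon> \<le> e i}. r)" by (intro sum_mono r) auto
    finally show ?thesis by simp
  qed
  have sw: "(\<Sum>i\<in>H. card {j \<in> H. e j \<le> e i}) = (\<Sum>i\<in>H. card {j \<in> H. e i \<le> e j})"
    using sum.swap[of "\<lambda>i j. if e j \<le> e i then 1 else 0 :: nat" H H]
    by (simp add: sum.If_cases fin Int_def)
  have "card H ^ 2 = (\<Sum>i\<in>H. card H)" by (simp add: power2_eq_square)
  also have "\<dots> \<le> (\<Sum>i\<in>H. card {j \<in> H. e j \<le> e i} + card {j \<in> H. e i \<le> e j})"
  proof (intro sum_mono)
    fix i
    have "card H \<le> card ({j \<in> H. e j \<le> e i} \<union> {j \<in> H. e i \<le> e j})"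
      using fin by (intro card_mono) auto
    then show "card H \<le> card {j \<in> H. e j \<le> e i} + card {j \<in> H. e i \<le> e j}"
      using card_Un_le le_trans by blast
  qed
  also have "\<dots> = 2 * (\<Sum>i\<in>H. card {j \<in> H. e j \<le> e i})"
    using sw by (simp add: sum.distrib)
  also have "\<dots> \<le> 2 * (\<Sum>i\<in>H. card {\<epsilon> \<in> e ` H. \<epsilon> \<le> e i} * r)"
    using le by (intro mult_left_mono sum_mono) auto
  also have "\<dots> \<le> 2 * (V * r)" using V by (simp add: sum_distrib_right[symmetric])
  finally show ?thesis using \<epsilon> by (auto simp: mult.assoc)
qed simp

text \<open>The least value with at least half of the indices at or below it works: if fewer than
  half were at or above it, the next smaller value would qualify too.\<close>

lemma median_split:
  fixes \<rho> :: "'a \<Rightarrow> real"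
  assumes fin: "finite I"
  shows "\<exists>\<tau>. card I \<le> 2 * card {i \<in> I. \<rho> i \<le> \<tau>} \<and> card I \<le> 2 * card {i \<in> I. \<tau> \<le> \<rho> i}"
proof (cases "I = {}")
  case False
  define R where "R = {\<tau> \<in> \<rho> ` I. card I \<le> 2 * card {i \<in> I. \<rho> i \<le> \<tau>}}"
  have "{i \<in> I. \<rho> i \<le> Max (\<rho> ` I)} = I" using fin by auto
  then have "Max (\<rho> ` I) \<in> R" unfolding R_def using fin False by (auto intro!: Max_in)
  then have ne: "R \<noteq> {}" and fR: "finite R" using fin by (auto simp: R_def)
  define \<tau> where "\<tau> = Min R"
  have \<tau>: "\<tau> \<in> R" unfolding \<tau>_def using ne fR by simp
  have "card I \<le> 2 * card {i \<in> I. \<tau> \<le> \<rho> i}"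
  proof (rule ccontr)
    assume less: "\<not> ?thesis"
    have "card I \<le> card ({i \<in> I. \<tau> \<le> \<rho> i} \<union> {i \<in> I. \<rho> i < \<tau>})"
      using fin by (intro card_mono) auto
    then have c: "card I \<le> card {i \<in> I. \<tau> \<le> \<rho> i} + card {i \<in> I. \<rho> i < \<tau>}"
      using card_Un_le le_trans by blast
    have ne': "{i \<in> I. \<rho> i < \<tau>} \<noteq> {}"
    proof
      assume "{i \<in> I. \<rho> i < \<tau>} = {}"
      then have "card I \<le> card {i \<in> I. \<tau> \<le> \<rho> i}" using c by (simp only: card.empty)
      then show False using less by linarith
    qed
    define \<sigma> where "\<sigma> = Max (\<rho> ` {i \<in> I. \<rho> i < \<tau>})"
    have \<sigma>in: "\<sigma> \<in> \<rho> ` {i \<in> I. \<rho> i < \<tau>}" unfolding \<sigma>_def using ne' fin by (intro Max_in) auto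
    have "\<rho> i \<le> \<sigma>" if "i \<in> I" "\<rho> i < \<tau>" for i
      unfolding \<sigma>_def using that fin by (intro Max_ge) auto
    then have "{i \<in> I. \<rho> i < \<tau>} \<subseteq> {i \<in> I. \<rho> i \<le> \<sigma>}" by auto
    then have "card {i \<in> I. \<rho> i < \<tau>} \<le> card {i \<in> I. \<rho> i \<le> \<sigma>}" using fin by (intro card_mono) auto
    then have "\<sigma> \<in> R" unfolding R_def using \<sigma>in c less by auto
    then have "\<tau> \<le> \<sigma>" unfolding \<tau>_def using fR by simp
    then show False using \<sigma>in by auto
  qed
  then show ?thesis using \<tau> by (auto simp: R_def)
qed simp

text \<open>Turns local counts into global ones. The intervals are half-open, so that consecutive
  steps sharing an endpoint still count as disjoint.\<close>

lemma sum_card_disjoint_intervals_le: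
  fixes lo hi :: "'a \<Rightarrow> real"
  assumes "finite S" "finite I"
    and "\<And>i. i \<in> I \<Longrightarrow> T i \<subseteq> S \<inter> {lo i<..hi i}"
    and "\<And>i j. i \<in> I \<Longrightarrow> j \<in> I \<Longrightarrow> i \<noteq> j \<Longrightarrow> hi i \<le> lo j \<or> hi j \<le> lo i"
  shows "(\<Sum>i\<in>I. card (T i)) \<le> card S"
proof -
  have "(\<Sum>i\<in>I. card (T i)) = card (\<Union>i\<in>I. T i)"
  proof (rule card_UN_disjoint[symmetric])
    show "\<forall>i\<in>I. finite (T i)" using assms(1,3) by (meson finite_Int finite_subset)
    show "\<forall>i\<in>I. \<forall>j\<in>I. i \<noteq> j \<longrightarrow> T i \<inter> T j = {}"
    proof (intro ballI impI)
      fix i j assume ij: "i \<in> I" "j \<in> I" "i \<noteq> j"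
      have "False" if "s \<in> T i" "s \<in> T j" for s
        using assms(3)[OF ij(1)] assms(3)[OF ij(2)] assms(4)[OF ij] that by fastforce
      then show "T i \<inter> T j = {}" by auto
    qed
  qed fact
  also have "\<dots> \<le> card S" using assms(1,3) by (intro card_mono) auto
  finally show ?thesis .
qed

section \<open>Sumsets and chains\<close>

definition setadd :: "real set \<Rightarrow> real set \<Rightarrow> real set" where
  "setadd A B = (\<lambda>(a, b). a + b) ` (A \<times> B)"

definition setdiff :: "real set \<Rightarrow> real set \<Rightarrow> real set" where
  "setdiff A B = (\<lambda>(a, b). a - b) ` (A \<times> B)"

lemma setaddI: "a \<in> A \<Longrightarrow> b \<in> B \<Longrightarrow> a + b \<in> setadd A B"
  by (force simp: setadd_def)

lemma setdiffI: "a \<in> A \<Longrightarrow> b \<in> B \<Longrightarrow> a - b \<in> setdiff A B"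
  by (force simp: setdiff_def)

lemma finite_setadd [simp]: "finite A \<Longrightarrow> finite B \<Longrightarrow> finite (setadd A B)"
  by (simp add: setadd_def)

lemma finite_setdiff [simp]: "finite A \<Longrightarrow> finite B \<Longrightarrow> finite (setdiff A B)"
  by (simp add: setdiff_def)

lemma setadd_assoc: "setadd (setadd A B) C = setadd A (setadd B C)"
proof
  show "setadd (setadd A B) C \<subseteq> setadd A (setadd B C)"
    by (auto simp: setadd_def add.assoc image_iff) (metis)
  show "setadd A (setadd B C) \<subseteq> setadd (setadd A B) C"
    by (auto simp: setadd_def add.assoc[symmetric] image_iff) (metis)
qed

lemma setadd_commute: "setadd A B = setadd B A"
  by (auto simp: setadd_def image_iff) (metis add.commute)+

lemma setadd_mono: "A \<subseteq> A' \<Longrightarrow> B \<subseteq> B' \<Longrightarrow> setadd A B \<subseteq> setadd A' B'"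
  by (auto simp: setadd_def)

lemma card_le_setadd:
  assumes "finite A" "finite B" "B \<noteq> {}"
  shows "card A \<le> card (setadd A B)"
proof -
  from assms obtain b where b: "b \<in> B" by auto
  have "card A = card ((\<lambda>a. a + b) ` A)" by (simp add: card_image inj_on_def)
  also have "\<dots> \<le> card (setadd A B)" using assms b by (intro card_mono) (auto intro: setaddI)
  finally show ?thesis .
qed

lemma sumset_0 [simp]: "sumset 0 A = {0}"
  by (auto simp: sumset_def)

lemma sumset_Suc: "sumset (Suc k) A = setadd (sumset k A) A"
proof
  show "sumset (Suc k) A \<subseteq> setadd (sumset k A) A"
  proof
    fix s assume "s \<in> sumset (Suc k) A"
    then obtain a where a: "s = (\<Sum>i<Suc k. a i)" "\<forall>i<Suc k. a i \<in> A" by (auto simp: sumset_def)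
    have "(\<Sum>i<k. a i) \<in> sumset k A" unfolding sumset_def using a by auto
    then show "s \<in> setadd (sumset k A) A" using a by (auto intro!: setaddI)
  qed
  show "setadd (sumset k A) A \<subseteq> sumset (Suc k) A"
  proof
    fix s assume "s \<in> setadd (sumset k A) A"
    then obtain a b where a: "\<forall>i<k. a i \<in> A" "b \<in> A" "s = (\<Sum>i<k. a i) + b"
      by (auto simp: setadd_def sumset_def)
    have "s = (\<Sum>i<Suc k. (a(k := b)) i)" using a by simp
    moreover have "\<forall>i<Suc k. (a(k := b)) i \<in> A" using a by auto
    ultimately show "s \<in> sumset (Suc k) A" unfolding sumset_def by blast
  qed
qed

lemma setadd_zero [simp]: "setadd {0} A = A" "setadd A {0} = A"
  by (auto simp: setadd_def image_iff)

lemma setdiff_zero [simp]: "setdiff A {0} = A"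
  by (auto simp: setdiff_def image_iff)

lemma sumset_1 [simp]: "sumset (Suc 0) A = A"
  by (simp add: sumset_Suc)

lemma sumset_add: "sumset (j + k) A = setadd (sumset j A) (sumset k A)"
  by (induction k) (simp_all add: sumset_Suc setadd_assoc)

lemma finite_sumset [simp]: "finite A \<Longrightarrow> finite (sumset k A)"
  by (induction k) (simp_all add: sumset_Suc)

lemma sumset_nonempty: "A \<noteq> {} \<Longrightarrow> sumset k A \<noteq> {}"
  by (induction k) (auto simp: sumset_Suc setadd_def)

lemma sumset_mono: "A \<subseteq> B \<Longrightarrow> sumset k A \<subseteq> sumset k B"
  by (induction k) (simp_all add: sumset_Suc setadd_mono)

lemma multiple_in_sumset: "a \<in> A \<Longrightarrow> real k * a \<in> sumset k A"
proof (induction k)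
  case (Suc k)
  have "real (Suc k) * a = real k * a + a" by (simp add: algebra_simps)
  then show ?case using Suc by (simp add: sumset_Suc setaddI del: of_nat_Suc)
qed simp

lemma two_multiples_in_sumset:
  assumes "a \<in> A" "b \<in> A" "r \<le> k"
  shows "real (k - r) * a + real r * b \<in> sumset k A"
proof -
  have "sumset k A = setadd (sumset (k - r) A) (sumset r A)"
    using sumset_add[of "k - r" r A] assms by simp
  then show ?thesis using setaddI[OF multiple_in_sumset multiple_in_sumset] assms by metis
qed

lemma sumset_uminus: "sumset k (uminus ` A) = uminus ` sumset k A"
proof (induction k)
  case (Suc k)
  have "setadd (uminus ` B) (uminus ` A) = uminus ` setadd B A" for B
    by (force simp: setadd_def image_iff)
  then show ?case using Suc by (simp add: sumset_Suc)
qed simp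

text \<open>Fix a representation \<open>d = p - q\<close> of each difference. The map from
  \<open>(d, z)\<close> to \<open>(p + z, q + z)\<close> is injective: the difference of the
  coordinates returns \<open>d\<close>, hence \<open>p\<close> and then \<open>z\<close>.\<close>

lemma ruzsa_triangle_inequality:
  assumes "finite P" "finite Q" "finite Z"
  shows "card (setdiff P Q) * card Z \<le> card (setadd P Z) * card (setadd Q Z)"
proof -
  have "\<forall>d\<in>setdiff P Q. \<exists>pq. fst pq \<in> P \<and> snd pq \<in> Q \<and> d = fst pq - snd pq"
    by (force simp: setdiff_def)
  then obtain R where R: "\<And>d. d \<in> setdiff P Q \<Longrightarrow> fst (R d) \<in> P \<and> snd (R d) \<in> Q \<and> d = fst (R d) - snd (R d)"
    by metis
  define F where "F = (\<lambda>(d, z). (fst (R d) + z, snd (R d) + z))"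
  have "inj_on F (setdiff P Q \<times> Z)"
  proof (rule inj_onI, clarify)
    fix d z d' z' assume *: "d \<in> setdiff P Q" "d' \<in> setdiff P Q" "F (d, z) = F (d', z')"
    then have "fst (R d) + z - (snd (R d) + z) = fst (R d') + z' - (snd (R d') + z')"
      by (simp add: F_def)
    then have "d = d'" using R[OF *(1)] R[OF *(2)] by linarith
    then show "d = d' \<and> z = z'" using * by (simp add: F_def)
  qed
  then have "card (setdiff P Q \<times> Z) = card (F ` (setdiff P Q \<times> Z))" by (simp add: card_image)
  also have "\<dots> \<le> card (setadd P Z \<times> setadd Q Z)"
    using R assms by (intro card_mono) (auto simp: F_def intro!: setaddI)
  finally show ?thesis by (simp add: card_cartesian_product)
qed

section \<open>Enumerations, gaps and chains of sums\<close>

lemma finite_set_enumeration: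
  fixes X :: "real set"
  assumes "finite X" "card X = Suc m"
  shows "\<exists>x. strict_mono_on {..m} x \<and> X = x ` {..m}"
proof (intro exI conjI)
  let ?x = "\<lambda>i. sorted_list_of_set X ! i"
  have len: "length (sorted_list_of_set X) = Suc m" using assms by simp
  show "strict_mono_on {..m} ?x"
    by (rule strict_mono_onI)
      (use strict_sorted_list_of_set[of X] len in \<open>auto simp: sorted_wrt_iff_nth_less\<close>)
  have "X = set (sorted_list_of_set X)" using assms by simp
  also have "\<dots> = ?x ` {..<Suc m}" unfolding set_conv_nth using len by auto
  finally show "X = ?x ` {..m}" by (simp add: lessThan_Suc_atMost)
qed

abbreviation gap :: "(nat \<Rightarrow> real) \<Rightarrow> nat \<Rightarrow> real" where
  "gap x i \<equiv> x (Suc i) - x i"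

text \<open>The chain passes from \<open>k\<close> copies of \<open>x 0\<close> to \<open>k\<close> copies of \<open>x m\<close> by increasing the
  summands one at a time; its step \<open>(i, r)\<close> has length \<open>gap x i\<close>.\<close>

definition chain :: "(nat \<Rightarrow> real) \<Rightarrow> nat \<Rightarrow> nat \<times> nat \<Rightarrow> real" where
  "chain x k = (\<lambda>(i, r). real (k - r) * x i + real r * x (Suc i))"

lemma gap_pos: "strict_mono_on {..m} x \<Longrightarrow> i < m \<Longrightarrow> gap x i > 0"
  by (simp add: strict_mono_on_def)

lemma chain_in_sumset:
  assumes "i < m" "r \<le> k"
  shows "chain x k (i, r) \<in> sumset k (x ` {..m})"
  unfolding chain_def prod.case using assms by (intro two_multiples_in_sumset) auto

lemma chain_step: "r < k \<Longrightarrow> chain x k (i, r) + gap x i = chain x k (i, Suc r)"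
  by (simp add: chain_def algebra_simps of_nat_diff)

text \<open>Since \<open>chain x k (i, r)\<close> is \<open>k * x i + r * gap x i\<close>, the steps
  follow one another in the lexicographic order of \<open>(i, r)\<close>, and the block of
  \<open>i\<close> ends at \<open>k * x (Suc i)\<close>.\<close>

lemma chain_disjoint:
  assumes x: "strict_mono_on {..m} x" and "p \<in> {..<m} \<times> {..<k}" "q \<in> {..<m} \<times> {..<k}" "p \<noteq> q"
  shows "chain x k p + gap x (fst p) \<le> chain x k q \<or> chain x k q + gap x (fst q) \<le> chain x k p"
proof -
  have eq: "chain x k (i, r) = real k * x i + real r * gap x i" if "r \<le> k" for i r
    using that by (simp add: chain_def algebra_simps of_nat_diff)
  have *: "chain x k p + gap x (fst p) \<le> chain x k q"
    if pq: "p \<in> {..<m} \<times> {..<k}" "q \<in> {..<m} \<times> {..<k}" "fst p < fst q \<or> fst p = fst q \<and> snd p < snd q" for p q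
  proof -
    obtain i r j t where p: "p = (i, r)" and q: "q = (j, t)" by fastforce
    have b: "i < m" "r < k" "j < m" "t < k" using pq p q by auto
    have g: "gap x i > 0" "gap x j > 0" using gap_pos[OF x] b by auto
    have l: "chain x k p + gap x i = real k * x i + real (Suc r) * gap x i"
      using b by (simp add: p eq algebra_simps)
    show ?thesis
    proof (cases "i < j")
      case True
      have "real (Suc r) * gap x i \<le> real k * gap x i" using b g by (intro mult_right_mono) auto
      then have "chain x k p + gap x i \<le> real k * x (Suc i)" using l by (simp add: algebra_simps)
      also have "x (Suc i) \<le> x j" using x True b by (cases "Suc i = j") (auto simp: strict_mono_on_def less_imp_le)
      then have "real k * x (Suc i) \<le> real k * x j" by (intro mult_left_mono) auto
      also have "\<dots> \<le> chain x k q" using b g by (simp add: q eq)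
      finally show ?thesis by (simp add: p)
    next
      case False
      then have "i = j" "r < t" using pq p q by auto
      then have "real (Suc r) * gap x i \<le> real t * gap x i" using g by (intro mult_right_mono) auto
      then show ?thesis using l b \<open>i = j\<close> by (simp add: p q eq)
    qed
  qed
  show ?thesis using *[of p q] *[of q p] assms
    by (metis linorder_neqE_nat prod.collapse)
qed

text \<open>Used to recover the end of a step from its start and the number of positions it advances
  in \<open>S\<close>.\<close>

lemma endpoint_eq_of_card_eq:
  fixes S :: "real set"
  assumes "finite S" "e \<in> S" "e' \<in> S" "l < e" "l < e'"
    and "card (S \<inter> {l<..e}) = card (S \<inter> {l<..e'})"
  shows "e = e'"
proof -
  have *: "card (S \<inter> {l<..a}) < card (S \<inter> {l<..b})" if "b \<in> S" "l < b" "a < b" for a b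
  proof (rule psubset_card_mono)
    have "b \<in> S \<inter> {l<..b}" "b \<notin> S \<inter> {l<..a}" "S \<inter> {l<..a} \<subseteq> S \<inter> {l<..b}" using that by auto
    then show "S \<inter> {l<..a} \<subset> S \<inter> {l<..b}" by blast
  qed (use assms(1) in simp)
  show ?thesis
  proof (rule linorder_cases[of e e'])
    assume "e < e'"
    then show ?thesis using *[of e' e] assms(3,5,6) by linarith
  next
    assume "e' < e"
    then show ?thesis using *[of e e'] assms(2,4,6) by linarith
  qed
qed

text \<open>Each translate of the pair of chains by an element of \<open>B \<times> C\<close> gives \<open>m k\<close> pairs of
  consecutive points of \<open>S \<times> T\<close>. Such a pair of points determines the gaps, hence \<open>i\<close>, so that it
  arises at most \<open>k\<close> times; and on average the two coordinates advance by only
  \<open>card S / (m k)\<close> and \<open>card T / (m k)\<close> positions.\<close>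

lemma chain_incidence:
  assumes x: "strict_mono_on {..m} x" and y: "strict_mono_on {..m} y"
    and inj: "inj_on (\<lambda>i. (gap x i, gap y i)) {..<m}"
    and fin: "finite B" "finite C" and ne: "B \<noteq> {}" "C \<noteq> {}" and k: "k \<ge> 1"
  defines "S \<equiv> setadd B (sumset k (x ` {..m}))" and "T \<equiv> setadd C (sumset k (y ` {..m}))"
  shows "2 * m ^ 3 * k ^ 2 * (card B * card C) \<le> 9 * (card S * card T) ^ 2"
proof -
  define I where "I = ({..<m} \<times> {..<k}) \<times> (B \<times> C)"
  define u where "u = (\<lambda>(p, b, c::real). card (S \<inter> {b + chain x k p <.. b + chain x k p + gap x (fst p)}))"
  define v where "v = (\<lambda>(p, b::real, c). card (T \<inter> {c + chain y k p <.. c + chain y k p + gap y (fst p)}))"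
  have fS: "finite S" "finite T" using fin by (simp_all add: S_def T_def)
  have S_mem: "b + chain x k p \<in> S" "b + chain x k p + gap x (fst p) \<in> S"
    if "p \<in> {..<m} \<times> {..<k}" "b \<in> B" for p b
    using that chain_step[of "snd p" k x "fst p"] chain_in_sumset[of "fst p" m _ k x]
    by (auto simp: S_def add.assoc less_imp_le Suc_le_eq intro!: setaddI)
  have T_mem: "c + chain y k p \<in> T" "c + chain y k p + gap y (fst p) \<in> T"
    if "p \<in> {..<m} \<times> {..<k}" "c \<in> C" for p c
    using that chain_step[of "snd p" k y "fst p"] chain_in_sumset[of "fst p" m _ k y]
    by (auto simp: T_def add.assoc less_imp_le Suc_le_eq intro!: setaddI)
  have gx: "gap x (fst p) > 0" "gap y (fst p) > 0" if "p \<in> {..<m} \<times> {..<k}" for p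
    using gap_pos[OF x] gap_pos[OF y] that by auto
  have u1: "1 \<le> u q" if "q \<in> I" for q
  proof -
    obtain p b c where q: "q = (p, b, c)" "p \<in> {..<m} \<times> {..<k}" "b \<in> B"
      using \<open>q \<in> I\<close> unfolding I_def by blast
    have "b + chain x k p + gap x (fst p) \<in> S \<inter> {b + chain x k p <.. b + chain x k p + gap x (fst p)}"
      using S_mem gx q by auto
    then have "u q > 0" unfolding u_def q prod.case using fS by (auto simp: card_gt_0_iff)
    then show ?thesis by simp
  qed
  have v1: "1 \<le> v q" if "q \<in> I" for q
  proof -
    obtain p b c where q: "q = (p, b, c)" "p \<in> {..<m} \<times> {..<k}" "c \<in> C"
      using \<open>q \<in> I\<close> unfolding I_def by blast
    have "c + chain y k p + gap y (fst p) \<in> T \<inter> {c + chain y k p <.. c + chain y k p + gap y (fst p)}"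
      using T_mem gx q by auto
    then have "v q > 0" unfolding v_def q prod.case using fS by (auto simp: card_gt_0_iff)
    then show ?thesis by simp
  qed
  have su: "sum u I \<le> card B * card C * card S"
  proof -
    have "(\<Sum>p\<in>{..<m}\<times>{..<k}. u (p, z)) \<le> card S" for z
    proof (cases z)
      case (Pair b c)
      show ?thesis
        unfolding u_def Pair prod.case
        by (rule sum_card_disjoint_intervals_le[where lo = "\<lambda>p. b + chain x k p" and hi = "\<lambda>p. b + chain x k p + gap x (fst p)"])
          (use fS chain_disjoint[OF x] in \<open>auto simp: add.assoc\<close>)
    qed
    then have "(\<Sum>z\<in>B \<times> C. \<Sum>p\<in>{..<m}\<times>{..<k}. u (p, z)) \<le> (\<Sum>z\<in>B \<times> C. card S)"
      by (intro sum_mono)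
    moreover have "sum u I = (\<Sum>z\<in>B \<times> C. \<Sum>p\<in>{..<m}\<times>{..<k}. u (p, z))"
      by (subst sum.swap) (simp add: I_def sum.cartesian_product)
    ultimately show ?thesis by (simp add: card_cartesian_product)
  qed
  have sv: "sum v I \<le> card B * card C * card T"
  proof -
    have "(\<Sum>p\<in>{..<m}\<times>{..<k}. v (p, z)) \<le> card T" for z
    proof (cases z)
      case (Pair b c)
      show ?thesis
        unfolding v_def Pair prod.case
        by (rule sum_card_disjoint_intervals_le[where lo = "\<lambda>p. c + chain y k p" and hi = "\<lambda>p. c + chain y k p + gap y (fst p)"])
          (use fS chain_disjoint[OF y] in \<open>auto simp: add.assoc\<close>)
    qed
    then have "(\<Sum>z\<in>B \<times> C. \<Sum>p\<in>{..<m}\<times>{..<k}. v (p, z)) \<le> (\<Sum>z\<in>B \<times> C. card T)"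
      by (intro sum_mono)
    moreover have "sum v I = (\<Sum>z\<in>B \<times> C. \<Sum>p\<in>{..<m}\<times>{..<k}. v (p, z))"
      by (subst sum.swap) (simp add: I_def sum.cartesian_product)
    ultimately show ?thesis by (simp add: card_cartesian_product)
  qed
  have fib: "card {q \<in> I. u q = g \<and> v q = h} \<le> k * (card S * card T)" for g h
  proof -
    \<comment> \<open>\<open>F\<close> keeps \<open>r\<close> and both starting points. Once the
      advances \<open>g\<close> and \<open>h\<close> are fixed, the starting points determine the
      end points, hence both gaps and \<open>i\<close>; then \<open>b\<close> and \<open>c\<close>
      follow by subtraction.\<close>
    define F where "F = (\<lambda>(p, b, c). (snd p, b + chain x k p, c + chain y k p))"
    let ?Q = "{q \<in> I. u q = g \<and> v q = h}"
    have "inj_on F ?Q"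
    proof (rule inj_onI)
      fix q q' assume Q: "q \<in> ?Q" "q' \<in> ?Q" and F: "F q = F q'"
      obtain p b c where q: "q = (p, b, c)" "p \<in> {..<m} \<times> {..<k}" "b \<in> B" "c \<in> C"
        using Q unfolding I_def by blast
      obtain p' b' c' where q': "q' = (p', b', c')" "p' \<in> {..<m} \<times> {..<k}" "b' \<in> B" "c' \<in> C"
        using Q unfolding I_def by blast
      have eq: "snd p = snd p'" "b + chain x k p = b' + chain x k p'" "c + chain y k p = c' + chain y k p'"
        using F by (auto simp: F_def q q')
      have "u q = u q'" "v q = v q'" using Q by auto
      then have ceq: "card (S \<inter> {b + chain x k p <.. b + chain x k p + gap x (fst p)})
          = card (S \<inter> {b + chain x k p <.. b' + chain x k p' + gap x (fst p')})"
        "card (T \<inter> {c + chain y k p <.. c + chain y k p + gap y (fst p)})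
          = card (T \<inter> {c + chain y k p <.. c' + chain y k p' + gap y (fst p')})"
        unfolding u_def v_def q(1) q'(1) prod.case by (simp_all only: eq)
      have "b + chain x k p + gap x (fst p) = b' + chain x k p' + gap x (fst p')"
        by (rule endpoint_eq_of_card_eq[OF fS(1) S_mem(2) S_mem(2) _ _ ceq(1)])
          (use q q' gx eq in auto)
      moreover have "c + chain y k p + gap y (fst p) = c' + chain y k p' + gap y (fst p')"
        by (rule endpoint_eq_of_card_eq[OF fS(2) T_mem(2) T_mem(2) _ _ ceq(2)])
          (use q q' gx eq in auto)
      ultimately have "gap x (fst p) = gap x (fst p')" "gap y (fst p) = gap y (fst p')"
        using eq by linarith+
      then have "fst p = fst p'" using inj_onD[OF inj, of "fst p" "fst p'"] q q' by auto
      then have "p = p'" using eq by (simp add: prod_eq_iff)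
      then show "q = q'" using eq q q' by simp
    qed
    then have "card ?Q = card (F ` ?Q)" by (simp add: card_image)
    also have "\<dots> \<le> card ({..<k} \<times> (S \<times> T))"
    proof (rule card_mono)
      show "finite ({..<k} \<times> (S \<times> T))" using fS by simp
      show "F ` ?Q \<subseteq> {..<k} \<times> (S \<times> T)"
      proof
        fix z assume "z \<in> F ` ?Q"
        then obtain p b c where "z = F (p, b, c)" "p \<in> {..<m} \<times> {..<k}" "b \<in> B" "c \<in> C"
          unfolding I_def by blast
        then show "z \<in> {..<k} \<times> (S \<times> T)" using S_mem T_mem by (auto simp: F_def)
      qed
    qed
    finally show ?thesis by (simp add: card_cartesian_product)
  qed
  define n where "n = card B * card C"
  define s where "s = card S * card T"
  have n: "n > 0" using fin ne by (auto simp: n_def card_gt_0_iff)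
  have fI: "finite I" using fin by (simp add: I_def)
  have cI: "card I = m * k * n" by (simp add: I_def n_def card_cartesian_product)
  have "2 * (m * k * n) ^ 3 \<le> 9 * (k * s) * sum u I * sum v I"
    using card_cube_le_of_fibres[OF fI u1 v1 fib] by (simp add: cI s_def)
  also have "\<dots> \<le> 9 * (k * s) * (n * card S) * (n * card T)"
    using su sv by (intro mult_mono) (auto simp: n_def)
  finally have "(k * n ^ 2) * (2 * m ^ 3 * k ^ 2 * n) \<le> (k * n ^ 2) * (9 * s ^ 2)"
    by (simp add: s_def power2_eq_square power3_eq_cube algebra_simps)
  then show ?thesis using n k by (simp add: n_def s_def)
qed

text \<open>Adding to the start of a step any gap not longer than the step stays inside the step and
  gives a difference of the required form. So each step contains as many differences as the rank of
  its gap, and each \<open>i\<close> has \<open>k\<close> steps.\<close>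

lemma chain_gap_rank_sum:
  assumes x: "strict_mono_on {..m} x" and H: "H \<subseteq> {..<m}"
  shows "k * (\<Sum>i\<in>H. card {d \<in> gap x ` H. d \<le> gap x i})
    \<le> card (setdiff (sumset (Suc k) (x ` {..m})) (x ` {..m}))"
proof -
  have fH: "finite H" using H finite_subset by blast
  define T where "T p = (\<lambda>d. chain x k p + d) ` {d \<in> gap x ` H. d \<le> gap x (fst p)}" for p
  have "k * (\<Sum>i\<in>H. card {d \<in> gap x ` H. d \<le> gap x i}) = (\<Sum>p\<in>H \<times> {..<k}. card (T p))"
  proof -
    have "(\<Sum>p\<in>H \<times> {..<k}. card (T p)) = (\<Sum>i\<in>H. \<Sum>r<k. card (T (i, r)))"
      by (simp add: sum.cartesian_product)
    also have "\<dots> = (\<Sum>i\<in>H. k * card {d \<in> gap x ` H. d \<le> gap x i})"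
      by (simp add: T_def card_image inj_on_def)
    finally show ?thesis by (simp add: sum_distrib_left)
  qed
  also have "\<dots> \<le> card (setdiff (sumset (Suc k) (x ` {..m})) (x ` {..m}))"
  proof (rule sum_card_disjoint_intervals_le[where lo = "chain x k" and hi = "\<lambda>p. chain x k p + gap x (fst p)"])
    fix p assume p: "p \<in> H \<times> {..<k}"
    show "T p \<subseteq> setdiff (sumset (Suc k) (x ` {..m})) (x ` {..m}) \<inter> {chain x k p<..chain x k p + gap x (fst p)}"
    proof
      fix z assume "z \<in> T p"
      then obtain j where j: "j \<in> H" "gap x j \<le> gap x (fst p)" "z = chain x k p + gap x j" by (auto simp: T_def)
      have "chain x k p \<in> sumset k (x ` {..m})"
        using p H chain_in_sumset[of "fst p" m "snd p" k x] by auto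
      then have "chain x k p + x (Suc j) - x j \<in> setdiff (sumset (Suc k) (x ` {..m})) (x ` {..m})"
        unfolding sumset_Suc using j H by (intro setdiffI setaddI) auto
      then have "z \<in> setdiff (sumset (Suc k) (x ` {..m})) (x ` {..m})"
        unfolding j(3) by (simp add: algebra_simps)
      moreover have "gap x j > 0" using gap_pos[OF x] j H by auto
      ultimately show "z \<in> setdiff (sumset (Suc k) (x ` {..m})) (x ` {..m}) \<inter> {chain x k p<..chain x k p + gap x (fst p)}"
        using j by auto
    qed
  next
    fix p q assume "p \<in> H \<times> {..<k}" "q \<in> H \<times> {..<k}" "p \<noteq> q"
    then show "chain x k p + gap x (fst p) \<le> chain x k q \<or> chain x k q + gap x (fst q) \<le> chain x k p"
      using H by (intro chain_disjoint[OF x]) auto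
  qed (use fH in auto)
  finally show ?thesis .
qed

lemma rank_eq_imp_eq:
  fixes D :: "real set"
  assumes "finite D" "a \<in> D" "b \<in> D" "card {d \<in> D. d \<le> a} = card {d \<in> D. d \<le> b}"
  shows "a = b"
proof -
  have *: "card {d \<in> D. d \<le> a} < card {d \<in> D. d \<le> b}" if "b \<in> D" "a < b" for a b
  proof (rule psubset_card_mono)
    have "b \<in> {d \<in> D. d \<le> b}" "b \<notin> {d \<in> D. d \<le> a}" "{d \<in> D. d \<le> a} \<subseteq> {d \<in> D. d \<le> b}"
      using that by auto
    then show "{d \<in> D. d \<le> a} \<subset> {d \<in> D. d \<le> b}" by blast
  qed (use assms(1) in simp)
  show ?thesis
  proof (rule linorder_cases[of a b])
    assume "a < b"
    then show ?thesis using *[of b a] assms(3,4) by linarith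
  next
    assume "b < a"
    then show ?thesis using *[of a b] assms(2,4) by linarith
  qed
qed

text \<open>The ranks of the two gaps determine \<open>i\<close>, so the cube bound applies with
  fibres of size 1. The factor \<open>k ^ 2\<close> comes from the \<open>k\<close> steps that each
  index has in both chains.\<close>

lemma chain_differences:
  assumes x: "strict_mono_on {..m} x" and y: "strict_mono_on {..m} y"
    and inj: "inj_on (\<lambda>i. (gap x i, gap y i)) {..<m}"
  defines "X \<equiv> x ` {..m}" and "Y \<equiv> y ` {..m}"
  shows "2 * m ^ 3 * k ^ 2 \<le> 9 * card (setdiff (sumset (Suc k) X) X) * card (setdiff (sumset (Suc k) Y) Y)"
proof -
  define u where "u i = card {d \<in> gap x ` {..<m}. d \<le> gap x i}" for i
  define v where "v i = card {d \<in> gap y ` {..<m}. d \<le> gap y i}" for i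
  have "2 * card {..<m} ^ 3 \<le> 9 * 1 * sum u {..<m} * sum v {..<m}"
  proof (rule card_cube_le_of_fibres)
    fix i assume i: "i \<in> {..<m}"
    then have "gap x i \<in> {d \<in> gap x ` {..<m}. d \<le> gap x i}" "gap y i \<in> {d \<in> gap y ` {..<m}. d \<le> gap y i}" by auto
    then have "u i > 0" "v i > 0" unfolding u_def v_def by (auto simp: card_gt_0_iff)
    then show "1 \<le> u i" "1 \<le> v i" by auto
  next
    fix g h
    have "i = j" if "i < m" "j < m" "u i = u j" "v i = v j" for i j
    proof -
      have "gap x i = gap x j" "gap y i = gap y j"
        using that rank_eq_imp_eq[of "gap x ` {..<m}" "gap x i" "gap x j"]
          rank_eq_imp_eq[of "gap y ` {..<m}" "gap y i" "gap y j"] by (auto simp: u_def v_def)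
      then show ?thesis using inj that by (auto dest: inj_onD)
    qed
    then show "card {i \<in> {..<m}. u i = g \<and> v i = h} \<le> 1"
      by (auto simp: card_le_Suc0_iff_eq)
  qed auto
  then have "2 * m ^ 3 * k ^ 2 \<le> 9 * (k * sum u {..<m}) * (k * sum v {..<m})"
    using mult_right_mono[of "2 * m ^ 3" "9 * sum u {..<m} * sum v {..<m}" "k^2"]
    by (simp add: power2_eq_square algebra_simps)
  also have "\<dots> \<le> 9 * card (setdiff (sumset (Suc k) X) X) * card (setdiff (sumset (Suc k) Y) Y)"
    using chain_gap_rank_sum[OF x, of "{..<m}" k] chain_gap_rank_sum[OF y, of "{..<m}" k]
    unfolding u_def v_def X_def Y_def by (intro mult_mono) auto
  finally show ?thesis .
qed

section \<open>Growth under functions with alternating differences\<close>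

text \<open>A finite-difference form of complete monotonicity, cut off at depth \<open>k\<close>.
  The growth induction replaces \<open>g\<close> by \<open>g s - g (s + \<delta>)\<close> for a
  \<open>\<delta>\<close> not known beforehand, hence the quantifier over all of them.\<close>

primrec alternating :: "nat \<Rightarrow> (real \<Rightarrow> real) \<Rightarrow> bool" where
  "alternating 0 g \<longleftrightarrow> (\<forall>s>0. \<forall>t>s. g t < g s)"
| "alternating (Suc k) g \<longleftrightarrow> (\<forall>s>0. \<forall>t>s. g t < g s) \<and> (\<forall>\<delta>>0. alternating k (\<lambda>s. g s - g (s + \<delta>)))"

text \<open>The differential counterpart, for \<open>h\<close> equal to minus the derivative of
  \<open>g\<close>. As \<open>h'\<close> is minus the derivative of \<open>h\<close>, all the
  functions that occur are positive.\<close>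

primrec monotone_derivs :: "nat \<Rightarrow> (real \<Rightarrow> real) \<Rightarrow> bool" where
  "monotone_derivs 0 h \<longleftrightarrow> (\<forall>s>0. h s > 0)"
| "monotone_derivs (Suc k) h \<longleftrightarrow> (\<forall>s>0. h s > 0) \<and>
    (\<exists>h'. (\<forall>s>0. (h has_real_derivative - h' s) (at s)) \<and> monotone_derivs k h')"

lemma alternatingD: "alternating k g \<Longrightarrow> 0 < s \<Longrightarrow> s < t \<Longrightarrow> g t < g s"
  by (cases k) auto

lemma monotone_derivs_pos: "monotone_derivs k h \<Longrightarrow> s > 0 \<Longrightarrow> h s > 0"
  by (cases k) auto

lemma decreasing_of_deriv:
  fixes g h :: "real \<Rightarrow> real"
  assumes "\<And>s. s > 0 \<Longrightarrow> (g has_real_derivative - h s) (at s)" "\<And>s. s > 0 \<Longrightarrow> h s > 0" "0 < s" "s < t"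
  shows "g t < g s"
proof (rule DERIV_neg_imp_decreasing[OF \<open>s < t\<close>])
  fix u assume "s \<le> u" "u \<le> t"
  then have "u > 0" using \<open>0 < s\<close> by simp
  then show "\<exists>d. (g has_real_derivative d) (at u) \<and> d < 0"
    using assms(1)[of u] assms(2)[of u] by (intro exI[of _ "- h u"]) simp
qed

lemma deriv_difference:
  fixes g h :: "real \<Rightarrow> real"
  assumes "\<And>s. s > 0 \<Longrightarrow> (g has_real_derivative - h s) (at s)" "\<delta> > 0" "s > 0"
  shows "((\<lambda>s. g s - g (s + \<delta>)) has_real_derivative - (h s - h (s + \<delta>))) (at s)"
proof -
  have "((\<lambda>s. g (s + \<delta>)) has_real_derivative - h (s + \<delta>)) (at s)"
    using DERIV_shift[of g "- h (s + \<delta>)" s \<delta>] assms(1)[of "s + \<delta>"] assms(2,3) by simp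
  from DERIV_diff[OF assms(1)[OF assms(3)] this] show ?thesis by simp
qed

text \<open>One order is spent: the difference is positive because \<open>h\<close> decreases, which
  is the sign of its derivative; the derivative of the difference is again a difference.\<close>

lemma monotone_derivs_difference:
  "monotone_derivs (Suc k) h \<Longrightarrow> \<delta> > 0 \<Longrightarrow> monotone_derivs k (\<lambda>s. h s - h (s + \<delta>))"
proof (induction k arbitrary: h)
  case 0
  then show ?case using decreasing_of_deriv[of h] by fastforce
next
  case (Suc k)
  then obtain h' where h': "\<And>s. s > 0 \<Longrightarrow> (h has_real_derivative - h' s) (at s)" "monotone_derivs (Suc k) h'"
    by auto
  have "h (s + \<delta>) < h s" if "s > 0" for s
    using decreasing_of_deriv[of h h' s "s + \<delta>"] h' monotone_derivs_pos[OF h'(2)] that Suc.prems by simp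
  moreover have "((\<lambda>s. h s - h (s + \<delta>)) has_real_derivative - (h' s - h' (s + \<delta>))) (at s)" if "s > 0" for s
    by (rule deriv_difference) (use h' that Suc.prems in auto)
  ultimately show ?case using Suc.IH[OF h'(2) Suc.prems(2)]
    by (auto intro!: exI[of _ "\<lambda>s. h' s - h' (s + \<delta>)"])
qed

lemma alternating_of_deriv:
  "(\<And>s. s > 0 \<Longrightarrow> (g has_real_derivative - h s) (at s)) \<Longrightarrow> monotone_derivs k h \<Longrightarrow> alternating k g"
proof (induction k arbitrary: g h)
  case 0
  then show ?case using decreasing_of_deriv[of g h] by auto
next
  case (Suc k)
  have "g t < g s" if "0 < s" "s < t" for s t
    using decreasing_of_deriv[of g h] Suc.prems(1) monotone_derivs_pos[OF Suc.prems(2)] that by auto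
  moreover have "alternating k (\<lambda>s. g s - g (s + \<delta>))" if "\<delta> > 0" for \<delta>
    using deriv_difference[of g h \<delta>] Suc.prems monotone_derivs_difference[OF Suc.prems(2) that] that
    by (intro Suc.IH[of _ "\<lambda>s. h s - h (s + \<delta>)"]) auto
  ultimately show ?case by simp
qed

text \<open>Up to sign, the family is closed under differentiation, hence the general
  \<open>c\<close> and \<open>n\<close>. The exponent \<open>Suc n\<close> keeps the derivative from
  vanishing.\<close>

lemma monotone_derivs_inverse_power:
  "c > 0 \<Longrightarrow> monotone_derivs k (\<lambda>s. c / s ^ Suc n)"
proof (induction k arbitrary: c n)
  case (Suc k)
  have "((\<lambda>s. c / s ^ Suc n) has_real_derivative - (c * real (Suc n) / s ^ Suc (Suc n))) (at s)" if "s > 0" for s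
  proof -
    have "((\<lambda>s. c / s ^ Suc n) has_real_derivative (0 * s ^ Suc n - c * (real (Suc n) * s ^ n)) / (s ^ Suc n * s ^ Suc n)) (at s)"
      using that by (auto intro!: derivative_eq_intros simp del: power_Suc)
    moreover have "(0 * s ^ Suc n - c * (real (Suc n) * s ^ n)) / (s ^ Suc n * s ^ Suc n) = - (c * real (Suc n) / s ^ Suc (Suc n))"
      using that by (simp add: field_simps)
    ultimately show ?thesis by simp
  qed
  moreover have "monotone_derivs k (\<lambda>s. c * real (Suc n) / s ^ Suc (Suc n))"
    using Suc.IH[of "c * real (Suc n)" "Suc n"] Suc.prems by simp
  ultimately show ?case using Suc.prems unfolding monotone_derivs.simps
    by (intro conjI exI[of _ "\<lambda>s. c * real (Suc n) / s ^ Suc (Suc n)"]) simp_all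
qed auto

text \<open>The minus sign makes the function decreasing, with derivative
  \<open>- 1 / s\<close>.\<close>

lemma alternating_neg_ln: "alternating k (\<lambda>s. - ln s)"
proof (rule alternating_of_deriv)
  fix s :: real assume "s > 0"
  then show "((\<lambda>s. - ln s) has_real_derivative - (1 / s ^ Suc 0)) (at s)"
    by (auto intro!: derivative_eq_intros)
qed (rule monotone_derivs_inverse_power, simp)

text \<open>The argument is that of chains with \<open>k = 1\<close>, but the differences are
  confined to \<open>{y 0<..y m}\<close>, because the growth argument controls only the differences
  up to the maximum of the set.\<close>

lemma gap_rank_sum:
  assumes y: "strict_mono_on {..m} y" and H: "H \<subseteq> {..<m}"
  shows "(\<Sum>i\<in>H. card {d \<in> gap y ` H. d \<le> gap y i})
    \<le> card (setdiff (setadd (y ` {..m}) (y ` {..m})) (y ` {..m}) \<inter> {y 0<..y m})"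
proof -
  have fH: "finite H" using H finite_subset by blast
  define T where "T i = (\<lambda>d. y i + d) ` {d \<in> gap y ` H. d \<le> gap y i}" for i
  have mono: "y i \<le> y j" if "i \<le> j" "j \<le> m" for i j
    using y that by (cases "i = j") (auto simp: strict_mono_on_def less_imp_le)
  have "(\<Sum>i\<in>H. card {d \<in> gap y ` H. d \<le> gap y i}) = (\<Sum>i\<in>H. card (T i))"
    by (simp add: T_def card_image inj_on_def)
  also have "\<dots> \<le> card (setdiff (setadd (y ` {..m}) (y ` {..m})) (y ` {..m}) \<inter> {y 0<..y m})"
  proof (rule sum_card_disjoint_intervals_le[where lo = y and hi = "\<lambda>i. y (Suc i)"])
    fix i assume i: "i \<in> H"
    show "T i \<subseteq> setdiff (setadd (y ` {..m}) (y ` {..m})) (y ` {..m}) \<inter> {y 0<..y m} \<inter> {y i<..y (Suc i)}"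
    proof
      fix z assume "z \<in> T i"
      then obtain j where j: "j \<in> H" "gap y j \<le> gap y i" "z = y i + gap y j" by (auto simp: T_def)
      have "y i + y (Suc j) - y j \<in> setdiff (setadd (y ` {..m}) (y ` {..m})) (y ` {..m})"
        using i j H by (intro setdiffI setaddI) auto
      then have "z \<in> setdiff (setadd (y ` {..m}) (y ` {..m})) (y ` {..m})"
        unfolding j(3) by (simp add: algebra_simps)
      moreover have "gap y j > 0" using gap_pos[OF y] j H by auto
      moreover have "y 0 \<le> y i" "y (Suc i) \<le> y m" using mono[of 0 i] mono[of "Suc i" m] i H by auto
      ultimately show "z \<in> setdiff (setadd (y ` {..m}) (y ` {..m})) (y ` {..m}) \<inter> {y 0<..y m} \<inter> {y i<..y (Suc i)}"
        using j by auto
    qed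
  next
    fix i j assume "i \<in> H" "j \<in> H" "i \<noteq> j"
    then show "y (Suc i) \<le> y j \<or> y (Suc j) \<le> y i"
      using mono[of "Suc i" j] mono[of "Suc j" i] H by (auto simp: subset_eq not_le) (metis Suc_leI less_imp_le linorder_neqE_nat)
  qed (use fH in auto)
  finally show ?thesis .
qed

text \<open>The exponent of \<open>32 * w\<close> in the growth inequality. Passing from
  \<open>k\<close> to \<open>Suc k\<close> raises \<open>n^2 \<le> 32 * w * card A1\<close> to the
  power \<open>2 ^ Suc k - 1\<close>; thus \<open>loss 3 = 1 + 3 + 7 = 11\<close>.\<close>

primrec loss :: "nat \<Rightarrow> nat" where
  "loss 0 = 0"
| "loss (Suc k) = loss k + (2 ^ Suc k - 1)"

lemma sumset_image_differences:
  assumes "T' \<subseteq> setdiff T T"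
  shows "sumset k T' \<subseteq> setdiff (sumset k T) (sumset k T)"
proof (induction k)
  case (Suc k)
  show ?case
  proof
    fix z assume "z \<in> sumset (Suc k) T'"
    then obtain s t where z: "s \<in> sumset k T'" "t \<in> T'" "z = s + t" by (auto simp: sumset_Suc setadd_def)
    then obtain p q where pq: "p \<in> sumset k T" "q \<in> sumset k T" "s = p - q" using Suc by (auto simp: setdiff_def)
    obtain p' q' where pq': "p' \<in> T" "q' \<in> T" "t = p' - q'" using z assms by (auto simp: setdiff_def)
    have "p + p' - (q + q') \<in> setdiff (sumset (Suc k) T) (sumset (Suc k) T)"
      unfolding sumset_Suc using pq pq' by (intro setdiffI setaddI)
    moreover have "z = p + p' - (q + q')" using z pq pq' by simp
    ultimately show "z \<in> setdiff (sumset (Suc k) T) (sumset (Suc k) T)" by (simp only:)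
  qed
qed (simp add: setdiff_def)

text \<open>The points with a small \<open>g\<close>-gap contain many pairs with a common difference \<open>\<delta>\<close>; the values
  that the induction gives for \<open>g s - g (s + \<delta>)\<close> are then so small that they can be subtracted
  from \<open>g z\<close> without passing the next value of \<open>g\<close>, for all the \<open>z\<close> with a large \<open>g\<close>-gap.\<close>

lemma alternating_growth:
  assumes "alternating k g" "finite A" "A \<noteq> {}" "A \<subseteq> {0<..}"
    and "real (card (setdiff (setadd A A) A \<inter> {0<..Max A})) \<le> w" "w \<ge> 1"
  shows "\<exists>V. V \<subseteq> setdiff (sumset (2 ^ k) (g ` A)) (sumset (2 ^ k - 1) (g ` A)) \<and>
     (\<forall>v\<in>V. \<exists>s\<in>A. \<exists>t\<in>A. g s \<le> v \<and> v \<le> g t) \<and>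
     real (card A) ^ (2 ^ Suc k - 1) \<le> 4 ^ k * (32 * w) ^ loss k * real (card V)"
  using assms(1-5)
proof (induction k arbitrary: g A)
  case 0
  have "inj_on g A"
  proof (rule inj_onI)
    fix s t assume "s \<in> A" "t \<in> A" "g s = g t"
    then show "s = t" using alternatingD[OF 0(1), of s t] alternatingD[OF 0(1), of t s] 0(4)
      by (cases s t rule: linorder_cases) auto
  qed
  then show ?case by (intro exI[of _ "g ` A"]) (auto simp: card_image)
next
  case (Suc k)
  show ?case
  proof (cases "card A = 1")
    case True
    then obtain s where A: "A = {s}" by (auto simp: card_1_singleton_iff)
    have "real (2 ^ Suc k) * g s - real (2 ^ Suc k - 1) * g s
        \<in> setdiff (sumset (2 ^ Suc k) (g ` A)) (sumset (2 ^ Suc k - 1) (g ` A))"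
      using A by (intro setdiffI multiple_in_sumset) auto
    then have "g s \<in> setdiff (sumset (2 ^ Suc k) (g ` A)) (sumset (2 ^ Suc k - 1) (g ` A))"
      by (simp add: of_nat_diff algebra_simps)
    moreover have "1 \<le> (4::real) ^ Suc k * (32 * w) ^ loss (Suc k)"
    proof -
      have "(1::real) * 1 \<le> 4 ^ Suc k * (32 * w) ^ loss (Suc k)"
        using \<open>w \<ge> 1\<close> by (intro mult_mono one_le_power) auto
      then show ?thesis by simp
    qed
    ultimately show ?thesis using A by (intro exI[of _ "{g s}"]) auto
  next
    case False
    then obtain m where m: "card A = Suc m" "m \<ge> 1"
      using Suc.prems(2,3) by (metis One_nat_def Suc_le_eq card_eq_0_iff gr0I not0_implies_Suc)
    obtain y where y: "strict_mono_on {..m} y" and A: "A = y ` {..m}"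
      using finite_set_enumeration[OF Suc.prems(2) m(1)] by auto
    have mono: "y i \<le> y j" if "i \<le> j" "j \<le> m" for i j
      using y that by (cases "i = j") (auto simp: strict_mono_on_def less_imp_le)
    have ypos: "y i > 0" if "i \<le> m" for i using that Suc.prems(4) A by auto
    have Max: "Max A = y m" using A mono by (intro Max_eqI) auto
    define \<rho> where "\<rho> i = g (y i) - g (y (Suc i))" for i
    obtain \<tau> where \<tau>: "card {..<m} \<le> 2 * card {i \<in> {..<m}. \<rho> i \<le> \<tau>}" "card {..<m} \<le> 2 * card {i \<in> {..<m}. \<tau> \<le> \<rho> i}"
      using median_split[of "{..<m}" \<rho>] by auto
    \<comment> \<open>\<open>H\<close> has the small and \<open>Z\<close> the large
      \<open>g\<close>-gaps. Each has at least \<open>m / 2\<close> elements, and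
      \<open>m + 1 \<le> 2 * m\<close>, which explains the factors 4 in \<open>cH\<close>.\<close>
    define H where "H = {i \<in> {..<m}. \<rho> i \<le> \<tau>}"
    define Z where "Z = {i \<in> {..<m}. \<tau> \<le> \<rho> i}"
    define V0 where "V0 = card (setdiff (setadd A A) A \<inter> {0<..Max A})"
    have "(\<Sum>i\<in>H. card {d \<in> gap y ` H. d \<le> gap y i}) \<le> card (setdiff (setadd A A) A \<inter> {y 0<..y m})"
      unfolding A by (rule gap_rank_sum[OF y]) (auto simp: H_def)
    also have "\<dots> \<le> V0" unfolding V0_def Max using Suc.prems(2) ypos[of 0]
      by (intro card_mono) auto
    finally obtain \<delta> where \<delta>: "card H ^ 2 \<le> 2 * V0 * card {i \<in> H. gap y i = \<delta>}"
      using popular_value[of H "gap y" V0] by (auto simp: H_def)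
    define A1 where "A1 = y ` {i \<in> H. gap y i = \<delta>}"
    have cH: "card A \<le> 4 * card H" "card A \<le> 4 * card Z" using \<tau> m by (auto simp: H_def Z_def)
    have "card A1 = card {i \<in> H. gap y i = \<delta>}" unfolding A1_def
      by (rule card_image, rule inj_on_subset[OF strict_mono_on_imp_inj_on[OF y]]) (auto simp: H_def)
    then have cA1: "card H ^ 2 \<le> 2 * V0 * card A1" using \<delta> by simp
    have "card H > 0" using cH m by simp
    then have "card A1 > 0" using cA1 by (cases "card A1 = 0") auto
    then have A1: "A1 \<noteq> {}" "finite A1" by (auto simp: card_gt_0_iff)
    then obtain i where "i \<in> H" "gap y i = \<delta>" by (auto simp: A1_def)
    then have \<delta>pos: "\<delta> > 0" using gap_pos[OF y, of i] by (auto simp: H_def)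
    have sub: "A1 \<subseteq> A" by (auto simp: A1_def A H_def)
    define g' where "g' s = g s - g (s + \<delta>)" for s
    have alt: "alternating k g'" using Suc.prems(1) \<delta>pos by (auto simp: g'_def[abs_def])
    have g': "g' s = \<rho> i" if "i \<in> H" "gap y i = \<delta>" "s = y i" for s i
      using that by (simp add: g'_def \<rho>_def) (metis add.commute diff_add_cancel)
    \<comment> \<open>The maximum does not grow, so the bound \<open>w\<close> on the local
      differences passes unchanged to \<open>A1\<close>.\<close>
    have "Max A1 \<le> Max A" using sub A1 Suc.prems(2) by (intro Max_mono) auto
    then have "setdiff (setadd A1 A1) A1 \<inter> {0<..Max A1} \<subseteq> setdiff (setadd A A) A \<inter> {0<..Max A}"
      using sub by (force simp: setdiff_def setadd_def)
    then have "card (setdiff (setadd A1 A1) A1 \<inter> {0<..Max A1}) \<le> V0"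
      unfolding V0_def using Suc.prems(2) by (intro card_mono) auto
    then have w1: "real (card (setdiff (setadd A1 A1) A1 \<inter> {0<..Max A1})) \<le> w"
      using Suc.prems(5) by (simp add: V0_def)
    have A1_pos: "A1 \<subseteq> {0<..}" using sub Suc.prems(4) by auto
    obtain V1 where V1: "V1 \<subseteq> setdiff (sumset (2 ^ k) (g' ` A1)) (sumset (2 ^ k - 1) (g' ` A1))"
      "\<forall>v\<in>V1. \<exists>s\<in>A1. \<exists>t\<in>A1. g' s \<le> v \<and> v \<le> g' t"
      "real (card A1) ^ (2 ^ Suc k - 1) \<le> 4 ^ k * (32 * w) ^ loss k * real (card V1)"
      using Suc.IH[OF alt A1(2,1) A1_pos w1] by auto
    have gdec: "g (y j) \<le> g (y i)" if "i \<le> j" "j \<le> m" for i j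
      using alternatingD[OF Suc.prems(1), of "y i" "y j"] y that ypos
      by (cases "i = j") (auto simp: strict_mono_on_def less_imp_le)
    \<comment> \<open>This uses the bounds of \<open>V1\<close> by values of \<open>g'\<close>,
      which the induction carries along: those values are positive and, on \<open>A1\<close>, at
      most \<open>\<tau>\<close>.\<close>
    have v_bounds: "0 < v" "v \<le> \<rho> z" if vz: "v \<in> V1" "z \<in> Z" for v z
    proof -
      obtain s t where st: "s \<in> A1" "t \<in> A1" "g' s \<le> v" "v \<le> g' t" using bspec[OF V1(2) vz(1)] by blast
      have "g' s > 0" unfolding g'_def using alternatingD[OF Suc.prems(1), of s "s + \<delta>"] \<delta>pos st A1_pos by auto
      then show "0 < v" using st by simp
      obtain i where "i \<in> H" "gap y i = \<delta>" "t = y i" using st by (auto simp: A1_def)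
      then have "g' t \<le> \<tau>" using g' by (auto simp: H_def)
      then show "v \<le> \<rho> z" using st vz by (auto simp: Z_def)
    qed
    \<comment> \<open>For fixed \<open>z\<close> the values lie in
      \<open>{g (y (Suc z))..<g (y z)}\<close>. These intervals are disjoint for different
      \<open>z\<close>, so \<open>F\<close> is injective.\<close>
    define F where "F = (\<lambda>(z, v). g (y z) - v)"
    have Zm: "z < m" if "z \<in> Z" for z using that by (auto simp: Z_def)
    have F_bounds: "g (y (Suc z)) \<le> F (z, v)" "F (z, v) < g (y z)" if "z \<in> Z" "v \<in> V1" for z v
      using v_bounds[OF that(2,1)] by (auto simp: F_def \<rho>_def)
    have "inj_on F (Z \<times> V1)"
    proof (rule inj_onI, clarify)
      fix z v z' v' assume *: "z \<in> Z" "v \<in> V1" "z' \<in> Z" "v' \<in> V1" "F (z, v) = F (z', v')"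
      have "z = z'"
      proof (rule ccontr)
        assume "z \<noteq> z'"
        then consider "Suc z \<le> z'" | "Suc z' \<le> z" by linarith
        then show False
        proof cases
          case 1
          then have "g (y z') \<le> g (y (Suc z))" using gdec Zm[of z'] * by auto
          then show False using F_bounds[of z v] F_bounds[of z' v'] * by auto
        next
          case 2
          then have "g (y z) \<le> g (y (Suc z'))" using gdec Zm[of z] * by auto
          then show False using F_bounds[of z v] F_bounds[of z' v'] * by auto
        qed
      qed
      then show "z = z' \<and> v = v'" using * by (auto simp: F_def)
    qed
    then have cV: "card (F ` (Z \<times> V1)) = card Z * card V1" by (simp add: card_image card_cartesian_product)
    \<comment> \<open>Each \<open>g'\<close>-value is a difference of two \<open>g\<close>-values.
      Sorting by sign leaves \<open>N + (N - 1) + 1 = 2 * N\<close> positive and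
      \<open>N + (N - 1) = 2 * N - 1\<close> negative summands.\<close>
    have mem: "F (z, v) \<in> setdiff (sumset (2 ^ Suc k) (g ` A)) (sumset (2 ^ Suc k - 1) (g ` A))"
      if zv: "z \<in> Z" "v \<in> V1" for z v
    proof -
      define N :: nat where "N = 2 ^ k"
      have N: "N \<ge> 1" by (simp add: N_def)
      have "g' ` A1 \<subseteq> setdiff (g ` A) (g ` A)"
      proof
        fix u assume "u \<in> g' ` A1"
        then obtain i where i: "i \<in> H" "gap y i = \<delta>" "u = g' (y i)" by (auto simp: A1_def)
        then have "u = g (y i) - g (y (Suc i))" using g' by (simp add: \<rho>_def)
        then show "u \<in> setdiff (g ` A) (g ` A)" using i by (auto simp: A H_def intro!: setdiffI)
      qed
      note D = sumset_image_differences[OF this]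
      obtain p q where pq: "p \<in> sumset N (g' ` A1)" "q \<in> sumset (N - 1) (g' ` A1)" "v = p - q"
        using V1(1) zv(2) by (auto simp: setdiff_def N_def)
      obtain p1 p2 where p: "p1 \<in> sumset N (g ` A)" "p2 \<in> sumset N (g ` A)" "p = p1 - p2"
        using D[of N] pq(1) by (auto simp: setdiff_def)
      obtain q1 q2 where q: "q1 \<in> sumset (N - 1) (g ` A)" "q2 \<in> sumset (N - 1) (g ` A)" "q = q1 - q2"
        using D[of "N - 1"] pq(2) by (auto simp: setdiff_def)
      have gz: "g (y z) \<in> g ` A" using Zm[OF zv(1)] by (auto simp: A)
      have "q1 + g (y z) \<in> sumset N (g ` A)"
        using setaddI[OF q(1) gz] N by (simp add: sumset_Suc[symmetric])
      then have "p2 + (q1 + g (y z)) \<in> sumset (N + N) (g ` A)"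
        unfolding sumset_add using p by (intro setaddI)
      moreover have "p1 + q2 \<in> sumset (N + (N - 1)) (g ` A)"
        unfolding sumset_add using p q by (intro setaddI)
      ultimately have "p2 + (q1 + g (y z)) - (p1 + q2) \<in> setdiff (sumset (N + N) (g ` A)) (sumset (N + (N - 1)) (g ` A))"
        by (rule setdiffI)
      moreover have "p2 + (q1 + g (y z)) - (p1 + q2) = F (z, v)" using pq p q by (simp add: F_def)
      moreover have "N + N = 2 ^ Suc k" "N + (N - 1) = 2 ^ Suc k - 1" using N by (auto simp: N_def)
      ultimately show ?thesis by simp
    qed
    define n where "n = real (card A)"
    define e :: nat where "e = 2 ^ Suc k - 1"
    have n: "n > 0" using m by (simp add: n_def)
    have "(real (card A))^2 \<le> (4 * real (card H))^2" using cH by (intro power_mono) auto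
    also have "\<dots> = 16 * real (card H ^ 2)" by simp
    also have "\<dots> \<le> 16 * real (2 * V0 * card A1)" using cA1 by (simp only: of_nat_le_iff mult_le_cancel_left_pos)
    also have "\<dots> \<le> 32 * w * real (card A1)" using Suc.prems(5) by (simp add: V0_def mult_right_mono)
    finally have n1: "n^2 \<le> 32 * w * real (card A1)" by (simp add: n_def)
    have "(2::nat) ^ k \<ge> 1" by simp
    \<comment> \<open>One factor \<open>n\<close> is paid for by \<open>Z\<close>, and the remaining
      \<open>e\<close> factors \<open>n^2\<close> by \<open>A1\<close>.\<close>
    then have "2 ^ Suc (Suc k) - 1 = Suc (2 * e)" unfolding e_def power_Suc by linarith
    then have "n ^ (2 ^ Suc (Suc k) - 1) = n * (n^2) ^ e" by (simp add: power_mult)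
    also have "\<dots> \<le> (4 * real (card Z)) * (32 * w * real (card A1)) ^ e"
      using cH n1 n by (intro mult_mono power_mono) (auto simp: n_def)
    also have "\<dots> = (4 * real (card Z)) * (32 * w) ^ e * real (card A1) ^ e" by (simp add: power_mult_distrib)
    also have "\<dots> \<le> (4 * real (card Z)) * (32 * w) ^ e * (4 ^ k * (32 * w) ^ loss k * real (card V1))"
      using V1(3) \<open>w \<ge> 1\<close> by (intro mult_left_mono) (auto simp: e_def)
    also have "\<dots> = 4 ^ Suc k * (32 * w) ^ (loss k + e) * real (card Z * card V1)"
      by (simp add: power_add)
    finally have "real (card A) ^ (2 ^ Suc (Suc k) - 1) \<le> 4 ^ Suc k * (32 * w) ^ loss (Suc k) * real (card (F ` (Z \<times> V1)))"
      unfolding cV by (simp add: n_def e_def)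
    moreover have "\<exists>s\<in>A. \<exists>t\<in>A. g s \<le> F (z, v) \<and> F (z, v) \<le> g t" if "z \<in> Z" "v \<in> V1" for z v
      using F_bounds[OF that] Zm[OF that(1)]
      by (intro bexI[of _ "y (Suc z)"] bexI[of _ "y z"]) (auto simp: A)
    ultimately show ?thesis using mem by (intro exI[of _ "F ` (Z \<times> V1)"]) auto
  qed
qed

section \<open>Sums and products of a set of positive reals\<close>

lemma setdiff_mono: "A \<subseteq> A' \<Longrightarrow> B \<subseteq> B' \<Longrightarrow> setdiff A B \<subseteq> setdiff A' B'"
  by (auto simp: setdiff_def)

lemma setdiff_uminus: "setdiff (uminus ` A) (uminus ` B) = uminus ` setdiff A B"
  by (force simp: setdiff_def image_iff)

context
  fixes m :: nat and x :: "nat \<Rightarrow> real" and C :: "real set"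
begin

definition points where "points = x ` {..m}"
definition log_point where "log_point i = ln (x i)"
definition logs where "logs = log_point ` {..m}"
definition nsums where "nsums j = real (card (sumset j points))"

text \<open>\<open>C\<close> counts as the first of the \<open>j\<close> summands.\<close>

definition nprods where "nprods j = real (card (setadd C (sumset (j - 1) logs)))"
definition npairs where "npairs j = nsums j * nprods j"

lemma finite_points [simp]: "finite points" and finite_logs [simp]: "finite logs"
  by (simp_all add: points_def logs_def)

lemma points_logs_nonempty: "points \<noteq> {}" "logs \<noteq> {}"
  by (simp_all add: points_def logs_def)

context
  assumes x: "strict_mono_on {..m} x" and x_pos: "\<And>i. i \<le> m \<Longrightarrow> x i > 0"
    and finite_C: "finite C" and C_nonempty: "C \<noteq> {}" and m_pos: "m \<ge> 1"
begin

lemma log_point: "strict_mono_on {..m} log_point"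
  using x x_pos by (auto simp: strict_mono_on_def log_point_def)

text \<open>The logarithmic gap fixes the ratio of the neighbours and so
  \<open>gap x i / x i\<close>; together with \<open>gap x i\<close> this fixes
  \<open>x i\<close>.\<close>

lemma gap_pair_inj: "inj_on (\<lambda>i. (gap x i, gap log_point i)) {..<m}"
proof (rule inj_onI)
  fix i j assume i: "i \<in> {..<m}" and j: "j \<in> {..<m}" and eq: "(gap x i, gap log_point i) = (gap x j, gap log_point j)"
  have pos: "x i > 0" "x (Suc i) > 0" "x j > 0" "x (Suc j) > 0" using i j x_pos by auto
  have "gap x i > 0" using gap_pos[OF x] i by auto
  have "ln (x (Suc i) / x i) = ln (x (Suc j) / x j)" using eq pos by (simp add: log_point_def ln_div)
  then have "x (Suc i) / x i = x (Suc j) / x j" using pos by (simp add: ln_inj_iff)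
  then have "gap x i / x i = gap x j / x j" using pos by (simp add: diff_divide_distrib)
  moreover define t where "t = gap x i"
  ultimately have "t / x i = t / x j" using eq by simp
  then have "x i = x j" using pos \<open>gap x i > 0\<close> by (simp add: frac_eq_eq t_def[symmetric])
  then show "i = j" using strict_mono_on_imp_inj_on[OF x] i j by (auto dest: inj_onD)
qed

section \<open>Growth of the numbers of sums and products\<close>

lemma nsums_ge_1: "nsums j \<ge> 1"
  using sumset_nonempty[OF points_logs_nonempty(1), of j] finite_sumset[OF finite_points, of j]
  by (simp add: nsums_def Suc_le_eq card_gt_0_iff)

lemma nprods_ge_1: "nprods j \<ge> 1"
proof -
  have "setadd C (sumset (j - 1) logs) \<noteq> {}"
    using sumset_nonempty[OF points_logs_nonempty(2), of "j - 1"] C_nonempty by (auto simp: setadd_def)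
  then show ?thesis by (simp add: nprods_def Suc_le_eq card_gt_0_iff finite_C)
qed

lemma nsums_mono: "i \<le> j \<Longrightarrow> nsums i \<le> nsums j"
proof (induction rule: dec_induct)
  case (step n)
  have "nsums n \<le> nsums (Suc n)"
    using card_le_setadd[of "sumset n points" points] points_logs_nonempty by (simp add: nsums_def sumset_Suc)
  then show ?case using step by simp
qed simp

lemma nprods_mono: "i \<le> j \<Longrightarrow> nprods i \<le> nprods j"
proof (induction rule: dec_induct)
  case (step n)
  have "nprods n \<le> nprods (Suc n)"
  proof (cases n)
    case (Suc n')
    show ?thesis using card_le_setadd[of "setadd C (sumset n' logs)" logs] points_logs_nonempty finite_C
      by (simp add: nprods_def sumset_Suc setadd_assoc Suc)
  qed (simp add: nprods_def)
  then show ?case using step by simp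
qed simp

lemma npairs_pos: "npairs j > 0"
  using nsums_ge_1[of j] nprods_ge_1[of j] by (simp add: npairs_def)

text \<open>The translates in \<open>chain_incidence\<close> are taken from the
  \<open>j\<close>-fold sums and from \<open>C\<close> plus \<open>j - 1\<close> logarithms. Moving
  \<open>k\<close> summands at once gains the factor \<open>k ^ 2\<close>.\<close>

lemma npairs_step:
  assumes "j \<ge> 1" "k \<ge> 1"
  shows "2 * real m ^ 3 * real k ^ 2 * npairs j \<le> 9 * npairs (j + k) ^ 2"
proof -
  have ne: "sumset j points \<noteq> {}" "setadd C (sumset (j - 1) logs) \<noteq> {}"
    using nsums_ge_1[of j] nprods_ge_1[of j] by (auto simp: nsums_def nprods_def)
  have "j + k - 1 = j - 1 + k" using assms by simp
  then have eq: "sumset (j + k) points = setadd (sumset j points) (sumset k points)"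
    "setadd C (sumset (j + k - 1) logs) = setadd (setadd C (sumset (j - 1) logs)) (sumset k logs)"
    by (simp_all add: sumset_add setadd_assoc)
  have "2 * m ^ 3 * k ^ 2 * (card (sumset j points) * card (setadd C (sumset (j - 1) logs)))
     \<le> 9 * (card (sumset (j + k) points) * card (setadd C (sumset (j + k - 1) logs))) ^ 2"
    unfolding eq using chain_incidence[OF x log_point gap_pair_inj _ _ ne assms(2)] finite_C
    by (simp add: points_def[symmetric] logs_def[symmetric])
  then have "real (2 * m ^ 3 * k ^ 2 * (card (sumset j points) * card (setadd C (sumset (j - 1) logs))))
     \<le> real (9 * (card (sumset (j + k) points) * card (setadd C (sumset (j + k - 1) logs))) ^ 2)"
    by (simp only: of_nat_le_iff)
  then show ?thesis by (simp add: npairs_def nsums_def nprods_def)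
qed

lemma card_setdiff_points: "real (card (setdiff (sumset k points) (sumset l points))) * nsums j \<le> nsums (k + j) * nsums (l + j)"
  unfolding nsums_def sumset_add of_nat_mult[symmetric] of_nat_le_iff
  by (rule ruzsa_triangle_inequality) auto

text \<open>Ruzsa's inequality with \<open>C\<close> absorbed into the third set, so that the
  differences involve \<open>logs\<close> alone.\<close>

lemma card_setdiff_logs:
  assumes "j \<ge> 1"
  shows "real (card (setdiff (sumset k logs) (sumset l logs))) * nprods j \<le> nprods (k + j) * nprods (l + j)"
proof -
  have "setadd C (sumset (i + j - 1) logs) = setadd (sumset i logs) (setadd C (sumset (j - 1) logs))" for i
  proof -
    have "i + j - 1 = i + (j - 1)" using assms by simp
    then have "setadd C (sumset (i + j - 1) logs) = setadd C (setadd (sumset i logs) (sumset (j - 1) logs))"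
      by (simp only: sumset_add)
    then show ?thesis by (metis setadd_assoc setadd_commute)
  qed
  then show ?thesis
    unfolding nprods_def of_nat_mult[symmetric] of_nat_le_iff
    by (simp only:) (rule ruzsa_triangle_inequality, auto simp: finite_C)
qed

text \<open>Multiplies the lower bound for differences by Ruzsa's upper bounds. On the right one
  factor \<open>npairs (1 + j)\<close> has few summands, unlike in
  \<open>npairs_step\<close>.\<close>

lemma npairs_step_differences:
  assumes "j \<ge> 1"
  shows "2 * real m ^ 3 * real k ^ 2 * npairs j \<le> 9 * (npairs (Suc k + j) * npairs (1 + j))"
proof -
  define u where "u = real (card (setdiff (sumset (Suc k) points) (sumset 1 points)))"
  define v where "v = real (card (setdiff (sumset (Suc k) logs) (sumset 1 logs)))"
  have "2 * m ^ 3 * k ^ 2 \<le> 9 * card (setdiff (sumset (Suc k) points) points) * card (setdiff (sumset (Suc k) logs) logs)"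
    unfolding points_def logs_def by (rule chain_differences[OF x log_point gap_pair_inj])
  then have "real (2 * m ^ 3 * k ^ 2) \<le> real (9 * card (setdiff (sumset (Suc k) points) points) * card (setdiff (sumset (Suc k) logs) logs))"
    by (simp only: of_nat_le_iff)
  then have "2 * real m ^ 3 * real k ^ 2 \<le> 9 * (u * v)" by (simp add: u_def v_def)
  then have "2 * real m ^ 3 * real k ^ 2 * npairs j \<le> 9 * (u * v) * npairs j"
    using npairs_pos[of j] by (intro mult_right_mono) auto
  also have "\<dots> = 9 * ((u * nsums j) * (v * nprods j))" by (simp add: npairs_def)
  also have "(u * nsums j) * (v * nprods j) \<le> (nsums (Suc k + j) * nsums (1 + j)) * (nprods (Suc k + j) * nprods (1 + j))"
  proof (rule mult_mono)
    show "u * nsums j \<le> nsums (Suc k + j) * nsums (1 + j)" unfolding u_def by (rule card_setdiff_points)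
    show "v * nprods j \<le> nprods (Suc k + j) * nprods (1 + j)" unfolding v_def by (rule card_setdiff_logs[OF assms])
    show "0 \<le> nsums (Suc k + j) * nsums (1 + j)" using nsums_ge_1[of "Suc k + j"] nsums_ge_1[of "1 + j"] by simp
    show "0 \<le> v * nprods j" using nprods_ge_1[of j] by (simp add: v_def)
  qed
  finally show ?thesis by (simp add: npairs_def mult_ac)
qed

text \<open>Put \<open>q = 2 / 9 * m ^ 3\<close>. The case \<open>k = 1\<close> of
  \<open>npairs_step\<close> says that the ratio of \<open>npairs\<close> to \<open>q\<close> at the
  next index is at least the square root of the current one; it starts at no less than
  \<open>1 / (2 * m)\<close>.\<close>

lemma npairs_lower_bound:
  assumes "real m \<le> 8 * real (card C)"
  shows "2 / 9 * real m ^ 3 * (2 * real m) powr (- ((1/2) ^ j)) \<le> npairs (Suc j)"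
proof (induction j)
  case 0
  have "card points = Suc m" unfolding points_def using strict_mono_on_imp_inj_on[OF x] by (simp add: card_image)
  then have "npairs (Suc 0) = (real m + 1) * real (card C)" by (simp add: npairs_def nsums_def nprods_def)
  also have "\<dots> \<ge> real m * (real m / 8)" using assms by (intro mult_mono) auto
  finally have "real m * real m \<le> 8 * npairs (Suc 0)" by simp
  then have "real m * real m \<le> 9 * npairs (Suc 0)" using npairs_pos[of "Suc 0"] by linarith
  then show ?case using m_pos by (simp add: powr_minus field_simps power3_eq_cube)
next
  case (Suc j)
  define q where "q = 2 / 9 * real m ^ 3"
  have q: "q > 0" using m_pos by (simp add: q_def)
  have "(q * (2 * real m) powr (- ((1/2) ^ Suc j))) ^ 2 = q * (q * (2 * real m) powr (- ((1/2) ^ j)))"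
    using m_pos by (simp add: power2_eq_square powr_add[symmetric])
  also have "\<dots> \<le> q * npairs (Suc j)"
    using mult_left_mono[OF Suc[folded q_def] less_imp_le[OF q]] .
  also have "\<dots> \<le> npairs (Suc (Suc j)) ^ 2" using npairs_step[of "Suc j" 1] by (simp add: q_def)
  finally have "q * (2 * real m) powr (- ((1/2) ^ Suc j)) \<le> npairs (Suc (Suc j))"
    by (rule power2_le_imp_le) (use npairs_pos[of "Suc (Suc j)"] in simp)
  then show ?case by (simp only: q_def)
qed

text \<open>The inequality \<open>npairs_step_differences\<close> bounds \<open>npairs j\<close> by a small multiple of \<open>npairs (1 + j)\<close>.
  Its repeated application from \<open>j = 10\<close> down to \<open>j = 8\<close> contradicts \<open>npairs_lower_bound\<close> unless \<open>m\<close> is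
  huge.\<close>

lemma gaps_ge_of_npairs_16_le:
  assumes C: "real m \<le> 8 * real (card C)" and P: "npairs 16 \<le> 208 / 100 * real m ^ 3"
  shows "2 * real m \<ge> 15 ^ 128"
proof -
  define M where "M = real m ^ 3"
  have M: "M > 0" using m_pos by (simp add: M_def)
  have pp: "npairs j \<ge> 0" for j using npairs_pos[of j] by simp
  have P: "npairs 16 \<le> 208 / 100 * M" using P by (simp add: M_def)
  have "npairs 16 ^ 2 \<le> (208 / 100 * M) ^ 2" using P pp by (intro power_mono)
  \<comment> \<open>Five summands are moved at once, from 11 to 16, whence
    \<open>25 = 5 ^ 2\<close>.\<close>
  moreover have "2 * M * 25 * npairs 11 \<le> 9 * npairs 16 ^ 2" using npairs_step[of 11 5] by (simp add: M_def)
  ultimately have "M * npairs 11 \<le> M * (M * (9 / 50 * (208 / 100)^2))" by (simp add: power2_eq_square)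
  then have p11: "npairs 11 \<le> M * (7788 / 10000)" using M by (simp add: power2_eq_square)
  have diff: "npairs j \<le> M * (9 / 2 * (208 / 100) * q / real k ^ 2)"
    if "j \<ge> 1" "k \<ge> 1" "Suc k + j = 16" "npairs (1 + j) \<le> M * q" for j k q
  proof -
    have "2 * M * real k ^ 2 * npairs j \<le> 9 * (npairs 16 * npairs (1 + j))"
      using npairs_step_differences[OF that(1), of k] that(3) by (simp add: M_def)
    also have "\<dots> \<le> 9 * ((208 / 100 * M) * (M * q))"
      using P that(4) pp M by (intro mult_left_mono mult_mono) auto
    finally have "M * (2 * real k ^ 2 * npairs j) \<le> M * (9 * (208 / 100) * M * q)"
      by (simp add: mult_ac)
    then have "2 * real k ^ 2 * npairs j \<le> 9 * (208 / 100) * M * q"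
      using M by (simp only: mult_le_cancel_left_pos)
    then show ?thesis using that(2) by (simp add: field_simps)
  qed
  have "npairs 10 \<le> M * (9 / 2 * (208 / 100) * (7788 / 10000) / real 5 ^ 2)"
    using p11 by (intro diff) auto
  then have p10: "npairs 10 \<le> M * (2916 / 10000)" using M by (auto elim!: order_trans)
  have "npairs 9 \<le> M * (9 / 2 * (208 / 100) * (2916 / 10000) / real 6 ^ 2)"
    using p10 by (intro diff) auto
  then have p9: "npairs 9 \<le> M * (759 / 10000)" using M by (auto elim!: order_trans)
  have "npairs 8 \<le> M * (9 / 2 * (208 / 100) * (759 / 10000) / real 7 ^ 2)"
    using p9 by (intro diff) auto
  then have p8: "npairs 8 \<le> M * (145 / 10000)" using M by (auto elim!: order_trans)
  \<comment> \<open>The index 8 is \<open>Suc 7\<close>, which gives the exponent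
    \<open>1 / 2 ^ 7 = 1 / 128\<close>; the quotient of \<open>2 / 9\<close> by
    \<open>145 / 10000\<close> exceeds 15.\<close>
  have "2 / 9 * M * (2 * real m) powr (- ((1/2) ^ 7)) \<le> M * (145 / 10000)"
    using npairs_lower_bound[OF C, of 7] p8 by(simp add: M_def)
  then have "M * (2 / 9 * (2 * real m) powr (- (1/128))) \<le> M * (145 / 10000)"
    by (simp add: mult_ac power_divide)
  then have "2 / 9 * (2 * real m) powr (- (1/128)) \<le> 145 / 10000"
    using M by (simp only: mult_le_cancel_left_pos)
  then have "15 \<le> (2 * real m) powr (1/128)"
    using m_pos by (simp add: powr_minus field_simps)
  then have "15 ^ 128 \<le> ((2 * real m) powr (1/128)) ^ 128" by (rule power_mono) simp
  also have "((2 * real m) powr (1/128)) ^ 128 = ((2 * real m) powr (1/128)) powr real 128"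
    using m_pos by (intro powr_realpow[symmetric]) simp
  also have "\<dots> = 2 * real m" using m_pos by (simp add: powr_powr)
  finally show ?thesis .
qed

text \<open>The indices with a given logarithmic gap \<open>\<epsilon>\<close> satisfy \<open>gap x i = (exp \<epsilon> - 1) * x i\<close>.
  The corresponding subset of \<open>points\<close> is therefore a dilate of a set of gaps of \<open>points\<close>, and so inherits
  few local sums.\<close>

lemma structured_subset:
  defines "V \<equiv> real (card (setdiff (sumset 2 logs) (sumset 1 logs)))"
    and "W \<equiv> real (card (setdiff (sumset 4 points) (sumset 3 points)))"
  shows "\<exists>A\<subseteq>points. A \<noteq> {} \<and> 2 * real m ^ 2 \<le> 9 * V * real (card A) \<and> real m \<le> 3 * W \<and>
    real (card (setdiff (setadd A A) A \<inter> {0<..Max A})) \<le> 3 * W / real m"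
proof -
  have xs: "x i \<in> points" if "i \<le> m" for i using that by (simp add: points_def)
  have three: "s + t + u \<in> sumset 3 points" if "s \<in> points" "t \<in> points" "u \<in> points" for s t u
    using that by (simp add: eval_nat_numeral sumset_Suc setaddI)
  define L where "L i = setdiff (sumset 3 points) (sumset 3 points) \<inter> {0<..gap x i}" for i
  define W' where "W' = card (setdiff (sumset 4 points) (sumset 3 points))"
  have finL: "finite (L i)" for i by (simp add: L_def)
  have "(\<Sum>i<m. card (L i)) = (\<Sum>i<m. card ((\<lambda>z. x i + z) ` L i))"
    by (simp add: card_image inj_on_def)
  also have "\<dots> \<le> W'" unfolding W'_def
  proof (rule sum_card_disjoint_intervals_le[where lo = x and hi = "\<lambda>i. x (Suc i)"])
    fix i assume i: "i \<in> {..<m}"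
    show "(\<lambda>z. x i + z) ` L i \<subseteq> setdiff (sumset 4 points) (sumset 3 points) \<inter> {x i<..x (Suc i)}"
    proof
      fix u assume "u \<in> (\<lambda>z. x i + z) ` L i"
      then obtain z where z: "z \<in> L i" "u = x i + z" by auto
      then obtain s t where st: "s \<in> sumset 3 points" "t \<in> sumset 3 points" "z = s - t" by (auto simp: L_def setdiff_def)
      have "s + x i \<in> sumset (Suc 3) points" unfolding sumset_Suc using st xs i by (intro setaddI) auto
      then have "s + x i - t \<in> setdiff (sumset 4 points) (sumset 3 points)" using st by (intro setdiffI) auto
      then show "u \<in> setdiff (sumset 4 points) (sumset 3 points) \<inter> {x i<..x (Suc i)}"
        using z st by (auto simp: L_def algebra_simps)
    qed
  next
    fix i j assume ij: "i \<in> {..<m}" "j \<in> {..<m}" "i \<noteq> j"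
    have *: "x (Suc i) \<le> x j" if "i < j" "j < m" for i j
      using x that by (cases "Suc i = j") (auto simp: strict_mono_on_def less_imp_le)
    show "x (Suc i) \<le> x j \<or> x (Suc j) \<le> x i" using *[of i j] *[of j i] ij by (metis lessThan_iff linorder_neqE_nat)
  qed auto
  finally have sumL: "(\<Sum>i<m. card (L i)) \<le> W'" .
  have "card (L i) \<ge> 1" if "i < m" for i
  proof -
    have "x (Suc i) + x 0 + x 0 - (x i + x 0 + x 0) \<in> setdiff (sumset 3 points) (sumset 3 points)"
      using that by (intro setdiffI three xs) auto
    then have "gap x i \<in> L i" using gap_pos[OF x that] by (simp add: L_def)
    then show ?thesis using finL[of i] by (auto simp: Suc_le_eq card_gt_0_iff)
  qed
  then have "(\<Sum>i<m. 1) \<le> (\<Sum>i<m. card (L i))" by (intro sum_mono) auto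
  then have mW: "m \<le> W'" using sumL by simp
  \<comment> \<open>Markov's inequality: the mean of \<open>card (L i)\<close> is at most
    \<open>W' / m\<close>, and at least two thirds of the indices do not exceed three times
    that.\<close>
  define G where "G = {i \<in> {..<m}. m * card (L i) \<le> 3 * W'}"
  have cG: "2 * m \<le> 3 * card G"
  proof -
    have "card ({..<m} - G) * (3 * W') = (\<Sum>i\<in>{..<m} - G. 3 * W')" by simp
    also have "\<dots> \<le> (\<Sum>i\<in>{..<m} - G. m * card (L i))" by (intro sum_mono) (auto simp: G_def)
    also have "\<dots> \<le> (\<Sum>i<m. m * card (L i))" by (intro sum_mono2) auto
    also have "\<dots> \<le> m * W'" using sumL by (simp add: sum_distrib_left[symmetric])
    finally have "card ({..<m} - G) * 3 \<le> m" using mW m_pos by (simp add: mult.assoc[symmetric])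
    moreover have "card ({..<m} - G) = m - card G" by (subst card_Diff_subset) (auto simp: G_def)
    moreover have "card G \<le> m" using card_mono[of "{..<m}" G] by (auto simp: G_def)
    ultimately show ?thesis by simp
  qed
  have two: "sumset 2 logs = setadd logs logs" by (simp add: eval_nat_numeral sumset_Suc)
  define V' where "V' = card (setdiff (setadd logs logs) logs)"
  have "(\<Sum>i\<in>G. card {d \<in> gap log_point ` G. d \<le> gap log_point i}) \<le> card (setdiff (setadd logs logs) logs \<inter> {log_point 0<..log_point m})"
    unfolding logs_def by (rule gap_rank_sum[OF log_point]) (auto simp: G_def)
  also have "\<dots> \<le> V'" unfolding V'_def by (intro card_mono) auto
  finally obtain \<epsilon> where \<epsilon>: "card G ^ 2 \<le> 2 * V' * card {i \<in> G. gap log_point i = \<epsilon>}"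
    using popular_value[of G "gap log_point" V'] by (auto simp: G_def)
  define A where "A = x ` {i \<in> G. gap log_point i = \<epsilon>}"
  have "card A = card {i \<in> G. gap log_point i = \<epsilon>}" unfolding A_def
    by (rule card_image, rule inj_on_subset[OF strict_mono_on_imp_inj_on[OF x]]) (auto simp: G_def)
  then have cA: "card G ^ 2 \<le> 2 * V' * card A" using \<epsilon> by simp
  have "card G > 0" using cG m_pos by simp
  then have "card A > 0" using cA by (cases "card A = 0") auto
  then have A: "A \<noteq> {}" "finite A" by (auto simp: card_gt_0_iff)
  have "4 * m ^ 2 = (2 * m) ^ 2" by (simp add: power2_eq_square)
  also have "\<dots> \<le> (3 * card G) ^ 2" using cG by (intro power_mono) auto
  also have "\<dots> = 9 * card G ^ 2" by (simp add: power2_eq_square)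
  also have "\<dots> \<le> 9 * (2 * V' * card A)" using cA by simp
  finally have "real (4 * m ^ 2) \<le> real (9 * (2 * V' * card A))" by (simp only: of_nat_le_iff)
  then have n: "2 * real m ^ 2 \<le> 9 * V * real (card A)" by (simp add: V_def V'_def two mult_ac)
  define q where "q = exp \<epsilon> - 1"
  have gapq: "gap x i = q * x i" if "i \<in> G" "gap log_point i = \<epsilon>" for i
  proof -
    have pos: "x i > 0" "x (Suc i) > 0" using that x_pos by (auto simp: G_def)
    have "exp \<epsilon> = exp (ln (x (Suc i)) - ln (x i))" using that by (simp add: log_point_def)
    also have "\<dots> = x (Suc i) / x i" using pos by (simp add: exp_diff)
    finally show ?thesis using pos by (simp add: q_def field_simps)
  qed
  obtain i0 where i0: "i0 \<in> G" "gap log_point i0 = \<epsilon>" "Max A = x i0" using Max_in[OF A(2,1)] by (auto simp: A_def)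
  have q: "q > 0"
    using gapq[OF i0(1,2)] gap_pos[OF x, of i0] x_pos[of i0] i0(1) by (auto simp: G_def zero_less_mult_iff)
  \<comment> \<open>Multiplication by \<open>q\<close> turns elements of \<open>A\<close> into gaps
    and \<open>Max A\<close> into \<open>gap x i0\<close>. A combination of three gaps is a
    difference of two 3-fold sums.\<close>
  have "card (setdiff (setadd A A) A \<inter> {0<..Max A}) = card ((\<lambda>z. q * z) ` (setdiff (setadd A A) A \<inter> {0<..Max A}))"
    using q by (simp add: card_image inj_on_def)
  also have "\<dots> \<le> card (L i0)"
  proof (rule card_mono[OF finL], rule subsetI)
    fix u assume "u \<in> (\<lambda>z. q * z) ` (setdiff (setadd A A) A \<inter> {0<..Max A})"
    then obtain i j k where ijk: "i \<in> G" "gap log_point i = \<epsilon>" "j \<in> G" "gap log_point j = \<epsilon>" "k \<in> G" "gap log_point k = \<epsilon>"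
      "u = q * (x i + x j - x k)" and z: "0 < x i + x j - x k" "x i + x j - x k \<le> x i0"
      unfolding i0(3)[symmetric] by (auto simp: A_def setdiff_def setadd_def)
    have "u = gap x i + gap x j - gap x k" using ijk gapq by (simp add: algebra_simps)
    then have "u = x (Suc i) + x (Suc j) + x k - (x i + x j + x (Suc k))" by simp
    moreover have "\<dots> \<in> setdiff (sumset 3 points) (sumset 3 points)"
      using ijk by (intro setdiffI three xs) (auto simp: G_def)
    moreover have "0 < u" "u \<le> gap x i0" using z q gapq[OF i0(1,2)] ijk by auto
    ultimately show "u \<in> L i0" by (auto simp: L_def)
  qed
  finally have "m * card (setdiff (setadd A A) A \<inter> {0<..Max A}) \<le> m * card (L i0)" by simp
  also have "\<dots> \<le> 3 * W'" using i0 by (simp add: G_def)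
  finally have "real (m * card (setdiff (setadd A A) A \<inter> {0<..Max A})) \<le> real (3 * W')" by (simp only: of_nat_le_iff)
  then have "real (card (setdiff (setadd A A) A \<inter> {0<..Max A})) \<le> 3 * W / real m"
    using m_pos by (simp add: W_def W'_def field_simps)
  moreover have "A \<subseteq> points" by (auto simp: A_def points_def G_def)
  moreover have "real m \<le> 3 * W" using mW by (simp add: W_def W'_def)
  ultimately show ?thesis using A n by blast
qed

text \<open>Growth at depth 3 for \<open>- ln\<close> on the structured subset bounds
  \<open>card A ^ 15\<close> by \<open>(W / m) ^ 11 * Q\<close>, and \<open>m ^ 2\<close> is bounded
  by \<open>V * card A\<close>, both up to constants. Eliminating \<open>card A\<close> leaves
  \<open>m ^ 41\<close> against \<open>V ^ 15 * W ^ 11 * Q\<close>, to which Ruzsa's inequality is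
  applied.\<close>

lemma growth_inequality:
  "2 ^ 15 * real m ^ 41 * npairs 12 ^ 26 * npairs 8 \<le> 9 ^ 15 * 64 * 96 ^ 11 * npairs 16 ^ 38 * nprods 16 ^ 5"
proof -
  define V where "V = real (card (setdiff (sumset 2 logs) (sumset 1 logs)))"
  define W where "W = real (card (setdiff (sumset 4 points) (sumset 3 points)))"
  define Q where "Q = real (card (setdiff (sumset 8 logs) (sumset 7 logs)))"
  have nonneg: "V \<ge> 0" "W \<ge> 0" "Q \<ge> 0" by (simp_all add: V_def W_def Q_def)
  obtain A where A: "A \<subseteq> points" "A \<noteq> {}" "2 * real m ^ 2 \<le> 9 * V * real (card A)" "real m \<le> 3 * W"
    "real (card (setdiff (setadd A A) A \<inter> {0<..Max A})) \<le> 3 * W / real m"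
    using structured_subset unfolding V_def W_def by blast
  have finA: "finite A" using A finite_points finite_subset by blast
  have Apos: "A \<subseteq> {0<..}" using A x_pos by (auto simp: points_def)
  have w1: "1 \<le> 3 * W / real m" using A m_pos by simp
  obtain U where U: "U \<subseteq> setdiff (sumset (2 ^ 3) ((\<lambda>s. - ln s) ` A)) (sumset (2 ^ 3 - 1) ((\<lambda>s. - ln s) ` A))"
    "real (card A) ^ (2 ^ Suc 3 - 1) \<le> 4 ^ 3 * (32 * (3 * W / real m)) ^ loss 3 * real (card U)"
    using alternating_growth[OF alternating_neg_ln finA A(2) Apos A(5) w1, of 3] by blast
  have img: "(\<lambda>s. - ln s) ` A \<subseteq> uminus ` logs" using A by (auto simp: points_def logs_def log_point_def)
  have "U \<subseteq> setdiff (sumset 8 (uminus ` logs)) (sumset 7 (uminus ` logs))"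
    using U(1) setdiff_mono[OF sumset_mono[OF img] sumset_mono[OF img], of 8 7] by auto
  then have "U \<subseteq> uminus ` setdiff (sumset 8 logs) (sumset 7 logs)"
    by (simp only: sumset_uminus setdiff_uminus)
  then have "card U \<le> card (uminus ` setdiff (sumset 8 logs) (sumset 7 logs))" by (intro card_mono) auto
  then have cU: "real (card U) \<le> Q" by (simp add: Q_def card_image)
  have "loss 3 = 11" by (simp add: eval_nat_numeral)
  then have n: "real (card A) ^ 15 \<le> 64 * (96 * W / real m) ^ 11 * real (card U)" using U(2) by simp
  also have "\<dots> \<le> 64 * (96 * W / real m) ^ 11 * Q" using cU nonneg by (intro mult_left_mono) auto
  finally have n: "real (card A) ^ 15 * real m ^ 11 \<le> 64 * (96 * W) ^ 11 * Q"
    using m_pos by (simp add: power_divide field_simps)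
  have "(2 * real m ^ 2) ^ 15 \<le> (9 * V * real (card A)) ^ 15" using A(3) by (intro power_mono) auto
  then have "(2 * real m ^ 2) ^ 15 * real m ^ 11 \<le> (9 * V * real (card A)) ^ 15 * real m ^ 11"
    by (intro mult_right_mono) auto
  also have "\<dots> = (9 * V) ^ 15 * (real (card A) ^ 15 * real m ^ 11)"
    by (simp only: power_mult_distrib mult.assoc)
  also have "\<dots> \<le> (9 * V) ^ 15 * (64 * (96 * W) ^ 11 * Q)" using n nonneg by (intro mult_left_mono) auto
  finally have main: "2 ^ 15 * real m ^ 41 \<le> 9 ^ 15 * 64 * 96 ^ 11 * (V ^ 15 * W ^ 11 * Q)"
    by (simp add: power_mult_distrib power_mult[symmetric] power_add[symmetric] mult_ac)
  have b0: "0 \<le> nsums j" "0 < nsums j" and c0: "0 \<le> nprods j" "0 < nprods j" for j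
    using nsums_ge_1[of j] nprods_ge_1[of j] by auto
  have "V * nprods 14 \<le> nprods 16 * nprods 15" using card_setdiff_logs[of 14 2 1] by (simp add: V_def)
  also have "\<dots> \<le> nprods 16 * nprods 16" using nprods_mono[of 15 16] c0 by (intro mult_left_mono) auto
  finally have V: "V * nprods 14 \<le> nprods 16 ^ 2" by (simp add: power2_eq_square)
  have "W * nsums 12 \<le> nsums 16 * nsums 15" using card_setdiff_points[of 4 3 12] by (simp add: W_def)
  also have "\<dots> \<le> nsums 16 * nsums 16" using nsums_mono[of 15 16] b0 by (intro mult_left_mono) auto
  finally have W: "W * nsums 12 \<le> nsums 16 ^ 2" by (simp add: power2_eq_square)
  have "Q * nprods 8 \<le> nprods 16 * nprods 15" using card_setdiff_logs[of 8 8 7] by (simp add: Q_def)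
  also have "\<dots> \<le> nprods 16 * nprods 16" using nprods_mono[of 15 16] c0 by (intro mult_left_mono) auto
  finally have Q: "Q * nprods 8 \<le> nprods 16 ^ 2" by (simp add: power2_eq_square)
  define K :: real where "K = 9 ^ 15 * 64 * 96 ^ 11"
  have K: "K \<ge> 0" by (simp add: K_def)
  \<comment> \<open>The denominators in Ruzsa's bounds are \<open>nprods 14\<close> for
    \<open>V\<close>, \<open>nsums 12\<close> for \<open>W\<close> and \<open>nprods 8\<close> for
    \<open>Q\<close>. Each factor \<open>npairs\<close> is enlarged so as to supply one of
    them.\<close>
  have "npairs 12 ^ 15 \<le> (nsums 16 * nprods 14) ^ 15"
    unfolding npairs_def using nsums_mono[of 12 16] nprods_mono[of 12 14] b0 c0
    by (intro power_mono mult_mono) auto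
  moreover have "npairs 12 ^ 11 \<le> (nsums 12 * nprods 16) ^ 11"
    unfolding npairs_def using nprods_mono[of 12 16] b0 c0 by (intro power_mono mult_mono) auto
  moreover have "npairs 8 \<le> nsums 16 * nprods 8"
    unfolding npairs_def using nsums_mono[of 8 16] b0 c0 by (intro mult_mono) auto
  ultimately have 1: "(npairs 12 ^ 15 * npairs 12 ^ 11) * npairs 8 \<le> ((nsums 16 * nprods 14) ^ 15 * (nsums 12 * nprods 16) ^ 11) * (nsums 16 * nprods 8)"
    using npairs_pos b0 c0 by (intro mult_mono) (auto intro: less_imp_le)
  have 2: "2 ^ 15 * real m ^ 41 \<le> K * (V ^ 15 * W ^ 11 * Q)" unfolding K_def by (rule main)
  have 3: "0 \<le> K * (V ^ 15 * W ^ 11 * Q)" using K nonneg by simp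
  have 4: "0 \<le> (npairs 12 ^ 15 * npairs 12 ^ 11) * npairs 8" using npairs_pos[of 12] npairs_pos[of 8] by simp
  have "2 ^ 15 * real m ^ 41 * ((npairs 12 ^ 15 * npairs 12 ^ 11) * npairs 8)
      \<le> (K * (V ^ 15 * W ^ 11 * Q)) * (((nsums 16 * nprods 14) ^ 15 * (nsums 12 * nprods 16) ^ 11) * (nsums 16 * nprods 8))"
    by (rule mult_mono[OF 2 1 3 4])
  also have "\<dots> = K * (nsums 16 ^ 16 * nprods 16 ^ 11) * (((V * nprods 14) ^ 15 * (W * nsums 12) ^ 11) * (Q * nprods 8))"
  proof -
    have "nsums 16 ^ 16 = nsums 16 * nsums 16 ^ 15" by (simp flip: power_Suc)
    then show ?thesis by (simp add: power_mult_distrib mult_ac)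
  qed
  also have "\<dots> \<le> K * (nsums 16 ^ 16 * nprods 16 ^ 11) * (((nprods 16 ^ 2) ^ 15 * (nsums 16 ^ 2) ^ 11) * nprods 16 ^ 2)"
    using V W Q nonneg K b0 c0 by (intro mult_left_mono mult_mono power_mono) auto
  also have "\<dots> = K * npairs 16 ^ 38 * nprods 16 ^ 5"
    by (simp add: npairs_def power_mult_distrib power_mult[symmetric] power_add[symmetric] mult_ac)
  finally show ?thesis by (simp add: K_def power_add[symmetric] mult_ac)
qed

end

end

section \<open>The sum-product estimate\<close>

lemma prodset_0 [simp]: "prodset 0 A = {1}"
  by (auto simp: prodset_def)

lemma prodset_SucI:
  assumes "s \<in> prodset k A" "b \<in> A"
  shows "s * b \<in> prodset (Suc k) A"
proof -
  obtain a where a: "\<forall>i<k. a i \<in> A" "s = (\<Prod>i<k. a i)" using assms by (auto simp: prodset_def)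
  have "s * b = (\<Prod>i<Suc k. (a(k := b)) i)" using a by simp
  moreover have "\<forall>i<Suc k. (a(k := b)) i \<in> A" using a assms by auto
  ultimately show ?thesis unfolding prodset_def by blast
qed

lemma finite_prodset: "finite A \<Longrightarrow> finite (prodset k A)"
proof (induction k)
  case (Suc k)
  have "prodset (Suc k) A \<subseteq> (\<lambda>(s, b). s * b) ` (prodset k A \<times> A)"
  proof
    fix z assume "z \<in> prodset (Suc k) A"
    then obtain a where a: "\<forall>i<Suc k. a i \<in> A" "z = (\<Prod>i<Suc k. a i)" by (auto simp: prodset_def)
    have "(\<Prod>i<k. a i) \<in> prodset k A" using a unfolding prodset_def by auto
    then show "z \<in> (\<lambda>(s, b). s * b) ` (prodset k A \<times> A)" using a by force
  qed
  then show ?case using Suc finite_subset by blast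
qed simp

text \<open>In the applications \<open>\<sigma>\<close> and \<open>\<tau>\<close> are signs, and
  \<open>X\<close> and \<open>C\<close> consist of absolute values of elements of \<open>A\<close>
  with these signs.\<close>

lemma signed_products_in_prodset:
  assumes "\<And>s. s \<in> X \<Longrightarrow> s > 0 \<and> \<sigma> * s \<in> A" "\<And>s. s \<in> C \<Longrightarrow> s > 0 \<and> \<tau> * s \<in> A"
    and "z \<in> setadd (ln ` C) (sumset k (ln ` X))"
  shows "\<sigma> ^ k * \<tau> * exp z \<in> prodset (Suc k) A"
proof -
  have *: "\<sigma> ^ k * exp z \<in> prodset k A" if "z \<in> sumset k (ln ` X)" for z
    using that
  proof (induction k arbitrary: z)
    case (Suc k)
    then obtain s t where st: "s \<in> sumset k (ln ` X)" "t \<in> X" "z = s + ln t"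
      by (auto simp: sumset_Suc setadd_def)
    have "\<sigma> ^ k * exp s * (\<sigma> * t) \<in> prodset (Suc k) A"
      using Suc.IH[OF st(1)] assms(1)[OF st(2)] by (intro prodset_SucI) auto
    moreover have "\<sigma> ^ Suc k * exp z = \<sigma> ^ k * exp s * (\<sigma> * t)"
      using assms(1)[OF st(2)] by (simp add: st(3) exp_add mult_ac)
    ultimately show ?case by (simp only:)
  qed simp
  obtain s t where st: "s \<in> C" "t \<in> sumset k (ln ` X)" "z = ln s + t" using assms(3) by (auto simp: setadd_def)
  have "\<sigma> ^ k * exp t * (\<tau> * s) \<in> prodset (Suc k) A"
    using *[OF st(2)] assms(2)[OF st(1)] by (intro prodset_SucI) auto
  moreover have "\<sigma> ^ k * \<tau> * exp z = \<sigma> ^ k * exp t * (\<tau> * s)"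
    using assms(2)[OF st(1)] by (simp add: st(3) exp_add mult_ac)
  ultimately show ?thesis by (simp only:)
qed

lemma card_signed_products:
  assumes "finite A" "\<And>s. s \<in> X \<Longrightarrow> s > 0 \<and> \<sigma> * s \<in> A" "\<And>s. s \<in> C \<Longrightarrow> s > 0 \<and> \<tau> * s \<in> A"
    and "\<sigma> ^ 15 * \<tau> = \<upsilon>" "\<upsilon> \<noteq> 0"
  shows "card (setadd (ln ` C) (sumset 15 (ln ` X))) \<le> card {s \<in> prodset 16 A. \<upsilon> * s > 0}"
proof -
  let ?T = "setadd (ln ` C) (sumset 15 (ln ` X))"
  have "card ?T = card ((\<lambda>z. \<upsilon> * exp z) ` ?T)"
    using assms(5) by (simp add: card_image inj_on_def)
  also have "\<dots> \<le> card {s \<in> prodset 16 A. \<upsilon> * s > 0}"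
  proof (rule card_mono)
    show "finite {s \<in> prodset 16 A. \<upsilon> * s > 0}" using finite_prodset[OF assms(1)] by simp
    have "\<upsilon> * exp z \<in> prodset 16 A" if "z \<in> ?T" for z
      using signed_products_in_prodset[OF assms(2,3) that] assms(4) by simp
    moreover have "\<upsilon> * (\<upsilon> * exp z) > 0" for z
    proof -
      have "\<upsilon> ^ 2 * exp z > 0" using assms(5) by simp
      then show ?thesis by (simp add: power2_eq_square mult.assoc)
    qed
    ultimately show "(\<lambda>z. \<upsilon> * exp z) ` ?T \<subseteq> {s \<in> prodset 16 A. \<upsilon> * s > 0}" by auto
  qed
  finally show ?thesis .
qed

lemma sumset_pos: "X \<subseteq> {0<..} \<Longrightarrow> s \<in> sumset (Suc k) X \<Longrightarrow> s > 0"
proof (induction k arbitrary: s)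
  case (Suc k)
  then obtain t u where "t \<in> sumset (Suc k) X" "u \<in> X" "s = t + u"
    by (subst (asm) (2) sumset_Suc) (auto simp: setadd_def)
  then show ?case using Suc by force
qed auto

text \<open>If both signs occur often, then both signs occur among the products, while the sums of positive
  and of negative elements are disjoint. This makes up for the loss of passing to one of the halves,
  up to the factor 2 (and a small loss from the boundary terms) in the constant \<open>208 / 100\<close>.\<close>

lemma positive_part:
  assumes fin: "finite A" and N: "card A \<ge> 250"
  shows "\<exists>X C. finite X \<and> X \<subseteq> {0<..} \<and> card X \<le> card A \<and> finite C \<and> C \<subseteq> {0<..} \<and> C \<noteq> {} \<and>
    real (card A) \<le> 6 * (real (card X) - 1) \<and> real (card X) - 1 \<le> 8 * real (card C) \<and>
    card (setadd (ln ` C) (sumset 15 (ln ` X))) \<le> card (prodset 16 A) \<and>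
    real (card (sumset 16 X)) * real (card (setadd (ln ` C) (sumset 15 (ln ` X)))) * real (card A) ^ 3
      \<le> 208 / 100 * (real (card X) - 1) ^ 3 * (real (card (sumset 16 A)) * real (card (prodset 16 A)))"
proof -
  define P where "P = A \<inter> {0<..}"
  define R where "R = uminus ` (A \<inter> {..<0})"
  define N where "N = real (card A)"
  define s where "s = real (card (sumset 16 A))"
  define t where "t = real (card (prodset 16 A))"
  define S where "S X = real (card (sumset 16 X))" for X
  define T where "T X C = real (card (setadd (ln ` C) (sumset 15 (ln ` X))))" for X C
  have finPR: "finite P" "finite R" using fin by (auto simp: P_def R_def)
  have pos: "P \<subseteq> {0<..}" "R \<subseteq> {0<..}" by (auto simp: P_def R_def)
  have P: "u > 0 \<and> 1 * u \<in> A" if "u \<in> P" for u using that by (auto simp: P_def)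
  have R: "u > 0 \<and> (- 1) * u \<in> A" if "u \<in> R" for u using that by (auto simp: R_def)
  have "A \<subseteq> P \<union> uminus ` R \<union> {0}" by (auto simp: P_def R_def image_image)
  then have "card A \<le> card (P \<union> uminus ` R \<union> {0})" using finPR by (intro card_mono) auto
  also have "\<dots> \<le> card P + card (uminus ` R) + 1"
    by (intro order_trans[OF card_Un_le] add_mono card_Un_le) auto
  also have "card (uminus ` R) = card R" by (simp add: card_image)
  finally have NPR: "N \<le> real (card P) + real (card R) + 1" by (simp add: N_def)
  have "P \<union> uminus ` R \<subseteq> A" "P \<inter> uminus ` R = {}" by (auto simp: P_def R_def)
  then have "card P + card (uminus ` R) \<le> card A"
    using fin finPR by (metis card_Un_disjoint card_mono finite_imageI)
  then have NPR': "real (card P) + real (card R) \<le> N" by (simp add: N_def card_image)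
  have N250: "N \<ge> 250" using N by (simp add: N_def)
  have finS: "finite (sumset 16 A)" "finite (prodset 16 A)" using fin finite_prodset by auto
  have SPR: "S P + S R \<le> s"
  proof -
    have "sumset 16 P \<subseteq> sumset 16 A" by (rule sumset_mono) (auto simp: P_def)
    moreover have "uminus ` sumset 16 R \<subseteq> sumset 16 A"
      unfolding sumset_uminus[symmetric] by (rule sumset_mono) (auto simp: R_def)
    moreover have "sumset 16 P \<inter> uminus ` sumset 16 R = {}"
      using sumset_pos[OF pos(1), of _ 15] sumset_pos[OF pos(2), of _ 15] by fastforce
    ultimately have "card (sumset 16 P) + card (uminus ` sumset 16 R) \<le> card (sumset 16 A)"
      using finS finPR by (metis Un_least card_Un_disjoint card_mono finite_imageI finite_sumset)
    then show ?thesis by (simp add: S_def s_def card_image)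
  qed
  have "card {u \<in> prodset 16 A. 1 * u > 0} + card {u \<in> prodset 16 A. (- 1) * u > 0}
      = card ({u \<in> prodset 16 A. 1 * u > 0} \<union> {u \<in> prodset 16 A. (- 1) * u > 0})"
    using finS by (intro card_Un_disjoint[symmetric]) auto
  also have "\<dots> \<le> card (prodset 16 A)" using finS by (intro card_mono) auto
  finally have signs: "card {u \<in> prodset 16 A. 1 * u > 0} + card {u \<in> prodset 16 A. (- 1) * u > 0} \<le> card (prodset 16 A)" .
  \<comment> \<open>With \<open>X = P\<close>, the choices \<open>C = P\<close> and
    \<open>C = R\<close> produce products of opposite signs, so the two numbers add up to at most
    \<open>t\<close>.\<close>
  have TP: "T P P + T P R \<le> t"
    using signs card_signed_products[OF fin P P, where X = P and C = P and \<upsilon> = 1] card_signed_products[OF fin P R, where X = P and C = R and \<upsilon> = "- 1"]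
    by (simp add: T_def t_def)
  have TR: "T R R + T R P \<le> t"
    using signs card_signed_products[OF fin R R, where X = R and C = R and \<upsilon> = 1] card_signed_products[OF fin R P, where X = R and C = P and \<upsilon> = "- 1"]
    by (simp add: T_def t_def)
  have nn: "0 \<le> S X" "0 \<le> T X C" "0 \<le> s" "0 \<le> t" for X C
    by (simp_all add: S_def T_def s_def t_def)
  define good where "good X C \<longleftrightarrow> finite X \<and> X \<subseteq> {0<..} \<and> real (card X) \<le> N \<and> finite C \<and> C \<subseteq> {0<..} \<and> C \<noteq> {} \<and>
      N \<le> 6 * (real (card X) - 1) \<and> real (card X) - 1 \<le> 8 * real (card C) \<and> T X C \<le> t \<and>
      S X * T X C * N ^ 3 \<le> 208 / 100 * (real (card X) - 1) ^ 3 * (s * t)" for X C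
  have one_sign: "good X X" if X: "finite X" "X \<subseteq> {0<..}" "T X X \<le> t" "S X \<le> s" "N \<le> real (card X) + N / 5 + 1" "real (card X) \<le> N" for X
  proof -
    \<comment> \<open>Here \<open>m \<ge> 4 / 5 * N - 2\<close>, and 2 is at most
      \<open>8 / 1000 * N\<close> for \<open>N \<ge> 250\<close>. The cube of
      \<open>792 / 1000\<close> times \<open>208 / 100\<close> exceeds 1.\<close>
    define m where "m = real (card X) - 1"
    have m: "792 / 1000 * N \<le> m" using X(5) N250 by (simp add: m_def)
    then have "0 \<le> m" using N250 by simp
    have "N ^ 3 \<le> 208 / 100 * (792 / 1000 * N) ^ 3"
      using N250 by (simp add: power_mult_distrib power3_eq_cube)
    also have "\<dots> \<le> 208 / 100 * m ^ 3" using m N250 by (intro mult_left_mono power_mono) auto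
    finally have "N ^ 3 * (S X * T X X) \<le> 208 / 100 * m ^ 3 * (s * t)"
      using X nn N250 \<open>0 \<le> m\<close> by (intro mult_mono) auto
    moreover have "X \<noteq> {}" using m N250 by (auto simp: m_def)
    ultimately show ?thesis using X m N250 by (auto simp: good_def m_def mult_ac)
  qed
  have half: "\<exists>C. good X C" if X: "finite X" "X \<subseteq> {0<..}" and Y: "finite Y" "Y \<subseteq> {0<..}" "N / 5 \<le> real (card X)" "N / 5 \<le> real (card Y)"
    and T: "T X X + T X Y \<le> t" and K: "N ^ 3 \<le> 416 / 100 * K" and S: "S X * K \<le> s * (real (card X) - 1) ^ 3"
    and XN: "real (card X) \<le> N" for X Y K
  proof -
    have "2 * T X X \<le> t \<or> 2 * T X Y \<le> t" using T by linarith
    then obtain C where C: "C = X \<or> C = Y" "2 * T X C \<le> t" by blast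
    have C': "finite C" "C \<subseteq> {0<..}" "N / 5 \<le> real (card C)" using C X Y by auto
    have "S X * T X C * N ^ 3 \<le> S X * T X C * (416 / 100 * K)" using K nn by (intro mult_left_mono) auto
    also have "\<dots> = 208 / 100 * (S X * K) * (2 * T X C)" by simp
    also have "\<dots> \<le> 208 / 100 * (s * (real (card X) - 1) ^ 3) * t"
    proof (rule mult_mono[OF mult_left_mono[OF S] C(2)])
      have "(real (card X) - 1) ^ 3 \<ge> 0" using Y N250 by simp
      then show "0 \<le> 208 / 100 * (s * (real (card X) - 1) ^ 3)" using nn by simp
    qed (use nn in auto)
    finally have "S X * T X C * N ^ 3 \<le> 208 / 100 * (real (card X) - 1) ^ 3 * (s * t)" by (simp add: mult_ac)
    moreover have "C \<noteq> {}" using C' N250 by auto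
    moreover have "T X C \<le> t" using C(2) nn(2)[of X C] by linarith
    moreover have "N \<le> 6 * (real (card X) - 1)" using Y(3) N250 by simp
    moreover have "real (card X) - 1 \<le> 8 * real (card C)" using C'(3) XN N250 by linarith
    ultimately have "good X C" unfolding good_def using X XN C' by blast
    then show ?thesis by blast
  qed
  have "\<exists>X C. good X C"
  proof -
    consider "real (card R) < N / 5" | "real (card P) < N / 5" | "N / 5 \<le> real (card P)" "N / 5 \<le> real (card R)"
      by linarith
    then show ?thesis
    proof cases
      case 1
      then have "good P P" using finPR pos TP SPR nn(1)[of P] nn(1)[of R] nn(2)[of P R] NPR NPR' by (intro one_sign) auto
      then show ?thesis by blast
    next
      case 2
      then have "good R R" using finPR pos TR SPR nn(1)[of P] nn(1)[of R] nn(2)[of R P] NPR NPR' by (intro one_sign) auto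
      then show ?thesis by blast
    next
      case 3
      define m1 where "m1 = real (card P) - 1"
      define m2 where "m2 = real (card R) - 1"
      define K where "K = m1 ^ 3 + m2 ^ 3"
      \<comment> \<open>At most three elements are lost, and 3 is at most
        \<open>12 / 1000 * N\<close>.\<close>
      have m: "m1 \<ge> 0" "m2 \<ge> 0" "988 / 1000 * N \<le> m1 + m2" using 3 N250 NPR by (auto simp: m1_def m2_def)
      have "4 * K - (m1 + m2) ^ 3 = 3 * (m1 + m2) * (m1 - m2) ^ 2"
        by (simp add: K_def power2_eq_square power3_eq_cube algebra_simps)
      moreover have "\<dots> \<ge> 0" using m by simp
      ultimately have "(m1 + m2) ^ 3 \<le> 4 * K" by simp
      moreover have "(988 / 1000 * N) ^ 3 \<le> (m1 + m2) ^ 3" using m N250 by (intro power_mono) auto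
      ultimately have "(988 / 1000 * N) ^ 3 \<le> 4 * K" by linarith
      then have "(988 / 1000) ^ 3 * N ^ 3 \<le> 4 * K" by (simp only: power_mult_distrib)
      moreover have "1 * N ^ 3 \<le> 104 / 100 * (988 / 1000) ^ 3 * N ^ 3"
        using N250 by (intro mult_right_mono) (auto simp: power3_eq_cube)
      ultimately have K: "N ^ 3 \<le> 416 / 100 * K" by linarith
      have "(S P + S R) * K \<le> s * K" using SPR m by (intro mult_right_mono) (auto simp: K_def)
      \<comment> \<open>If both failed, their sum would contradict \<open>S P + S R \<le> s\<close>.
        This choice of half makes the number of sums proportionate to the cube of its size.\<close>
      then have "S P * K \<le> s * m1 ^ 3 \<or> S R * K \<le> s * m2 ^ 3" by (auto simp: K_def algebra_simps)
      then show ?thesis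
      proof
        assume "S P * K \<le> s * m1 ^ 3"
        then show ?thesis using half[OF finPR(1) pos(1) finPR(2) pos(2) 3 TP K] NPR' by (auto simp: m1_def)
      next
        assume "S R * K \<le> s * m2 ^ 3"
        then show ?thesis using half[OF finPR(2) pos(2) finPR(1) pos(1) 3(2,1) TR K] NPR' by (auto simp: m2_def)
      qed
    qed
  qed
  then show ?thesis by (simp add: good_def S_def T_def N_def s_def t_def)
qed

lemma card_sumset_ge:
  assumes "finite A" "card A = Suc m"
  shows "k * m \<le> card (sumset k A)"
proof -
  obtain x where x: "strict_mono_on {..m} x" and A: "A = x ` {..m}"
    using finite_set_enumeration[OF assms] by auto
  define T where "T p = {chain x k p + gap x (fst p)}" for p
  have "k * m = (\<Sum>p\<in>{..<m}\<times>{..<k}. card (T p))" by (simp add: T_def)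
  also have "\<dots> \<le> card (sumset k A)"
  proof (rule sum_card_disjoint_intervals_le[where lo = "chain x k" and hi = "\<lambda>p. chain x k p + gap x (fst p)"])
    fix p assume p: "p \<in> {..<m} \<times> {..<k}"
    then have "chain x k p + gap x (fst p) \<in> sumset k A"
      using chain_step[of "snd p" k x "fst p"] chain_in_sumset[of "fst p" m "Suc (snd p)" k x] by (auto simp: A)
    then show "T p \<subseteq> sumset k A \<inter> {chain x k p<..chain x k p + gap x (fst p)}"
      using gap_pos[OF x, of "fst p"] p by (auto simp: T_def)
  qed (use chain_disjoint[OF x] assms in auto)
  finally show ?thesis .
qed

section \<open>Sets below and above \<open>2 ^ 498\<close> elements\<close>

lemma log_chain_reduction:
  assumes "finite A" "card A \<ge> 250"
  shows "\<exists>m x C. strict_mono_on {..m} x \<and> (\<forall>i\<le>m. 0 < x i) \<and> finite C \<and> C \<noteq> {} \<and> 1 \<le> m \<and> m \<le> card A \<and> real (card A) \<le> 6 * real m \<and> real m \<le> 8 * real (card C) \<and>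
    nprods m x C 16 \<le> real (card (prodset 16 A)) \<and>
    npairs m x C 16 * real (card A) ^ 3
      \<le> 208 / 100 * real m ^ 3 * (real (card (sumset 16 A)) * real (card (prodset 16 A)))"
proof -
  obtain X C where X: "finite X" "X \<subseteq> {0<..}" "card X \<le> card A" and C: "finite C" "C \<subseteq> {0<..}" "C \<noteq> {}"
    and le: "real (card A) \<le> 6 * (real (card X) - 1)" "real (card X) - 1 \<le> 8 * real (card C)"
    "card (setadd (ln ` C) (sumset 15 (ln ` X))) \<le> card (prodset 16 A)"
    "real (card (sumset 16 X)) * real (card (setadd (ln ` C) (sumset 15 (ln ` X)))) * real (card A) ^ 3
      \<le> 208 / 100 * (real (card X) - 1) ^ 3 * (real (card (sumset 16 A)) * real (card (prodset 16 A)))"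
    using positive_part[OF assms] by blast
  obtain m where m: "card X = Suc m" "m \<ge> 1"
    using le(1) assms(2) by (cases "card X") (auto simp: Suc_le_eq)
  obtain x where x: "strict_mono_on {..m} x" "X = x ` {..m}"
    using finite_set_enumeration[OF X(1) m(1)] by auto
  have eq: "points m x = X" "logs m x = ln ` X"
    by (auto simp: points_def logs_def log_point_def x(2) image_image)
  have "card (ln ` C) = card C"
    using C(2) by (intro card_image inj_onI) (auto simp: subset_eq ln_inj_iff)
  then show ?thesis
    using le m X(2,3) x C
    by (intro exI[of _ m] exI[of _ x] exI[of _ "ln ` C"]) (auto simp: npairs_def nsums_def nprods_def eq)
qed

lemma three_halves_strict:
  assumes A: "finite A" and N: "2 \<le> card A" "card A < 2 ^ 498"
  shows "card A ^ 3 < max (card (sumset 16 A)) (card (prodset 16 A)) ^ 2"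
proof (cases "card A < 250")
  case True
  obtain a where a: "card A = Suc a" "1 \<le> a" "a \<le> 248" using N True by (cases "card A") auto
  define z where "z = int a"
  have z: "1 \<le> z" "z \<le> 248" using a by (auto simp: z_def)
  \<comment> \<open>Expanding \<open>(z + 1) ^ 3 < 256 * z ^ 2\<close> leaves
    \<open>3 * z + 1 < z ^ 2 * (253 - z)\<close>, for which the factor 5 is enough.\<close>
  have "z * z * 5 \<le> z * z * (253 - z)" using z by (intro mult_left_mono) auto
  moreover have "z * z * (253 - z) = 253 * (z * z) - z * z * z" by (simp add: algebra_simps)
  moreover have "z * 1 \<le> z * z" using z by (intro mult_left_mono) auto
  moreover have "(z + 1) ^ 3 = z * z * z + 3 * (z * z) + 3 * z + 1" "(16 * z) ^ 2 = 256 * (z * z)"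
    by (simp_all add: power2_eq_square power3_eq_cube algebra_simps)
  ultimately have "(int a + 1) ^ 3 < (16 * int a) ^ 2" using z unfolding z_def by linarith
  then have "int (card A ^ 3) < int ((16 * a) ^ 2)" by (simp add: a(1) add.commute)
  then have "card A ^ 3 < (16 * a) ^ 2" by (simp only: of_nat_less_iff)
  also have "\<dots> \<le> max (card (sumset 16 A)) (card (prodset 16 A)) ^ 2"
    using card_sumset_ge[OF A a(1), of 16] by (intro power_mono) auto
  finally show ?thesis .
next
  case False
  define M where "M = max (card (sumset 16 A)) (card (prodset 16 A))"
  show ?thesis
  proof (rule ccontr)
    assume "\<not> ?thesis"
    then have M: "M ^ 2 \<le> card A ^ 3" by (simp add: M_def)
    obtain m x C where L: "strict_mono_on {..m} x" "\<And>i. i \<le> m \<Longrightarrow> 0 < x i" "finite C" "C \<noteq> {}" "1 \<le> m" and le: "m \<le> card A" "real m \<le> 8 * real (card C)"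
      "npairs m x C 16 * real (card A) ^ 3
        \<le> 208 / 100 * real m ^ 3 * (real (card (sumset 16 A)) * real (card (prodset 16 A)))"
      using log_chain_reduction[OF A] False by auto
    have "card (sumset 16 A) * card (prodset 16 A) \<le> M * M" unfolding M_def by (intro mult_mono) auto
    also have "\<dots> \<le> card A ^ 3" using M by (simp add: power2_eq_square)
    finally have "real (card (sumset 16 A) * card (prodset 16 A)) \<le> real (card A ^ 3)" by (simp only: of_nat_le_iff)
    then have "208 / 100 * real m ^ 3 * (real (card (sumset 16 A)) * real (card (prodset 16 A)))
        \<le> 208 / 100 * real m ^ 3 * real (card A) ^ 3" by (intro mult_left_mono) auto
    with le(3) have "npairs m x C 16 * real (card A) ^ 3 \<le> 208 / 100 * real m ^ 3 * real (card A) ^ 3" by linarith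
    then have "npairs m x C 16 \<le> 208 / 100 * real m ^ 3" using N by simp
    \<comment> \<open>This is where the threshold comes from: \<open>15 ^ 128\<close> exceeds
      \<open>2 * 2 ^ 498\<close>.\<close>
    from gaps_ge_of_npairs_16_le[OF L le(2) this] have "15 ^ 128 \<le> 2 * real m" .
    also have "real m \<le> real (2 ^ 498)" using le(1) N by (simp only: of_nat_le_iff)
    finally show False by simp
  qed
qed

text \<open>If the bound failed, the growth inequality would give \<open>m ^ (41 + 81)\<close> at
  most about \<open>m ^ 114 * u powr (15 / 2)\<close> with \<open>u = 6 * m\<close>. The surplus of
  \<open>8 - 15 / 2\<close> in the exponent absorbs the small powers and the constants.\<close>

lemma three_halves_plus:
  assumes A: "finite A" and N: "2 ^ 498 \<le> card A"
  shows "real (card A) powr (3 / 2 + 1 / 10 ^ 6) \<le> real (max (card (sumset 16 A)) (card (prodset 16 A)))"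
proof (rule ccontr)
  assume contra: "\<not> ?thesis"
  define n where "n = real (card A)"
  define M where "M = real (max (card (sumset 16 A)) (card (prodset 16 A)))"
  define \<epsilon> :: real where "\<epsilon> = 1 / 10 ^ 6"
  have "real (2 ^ 498) \<le> n" using N unfolding n_def by (simp only: of_nat_le_iff)
  then have n: "2 ^ 498 \<le> n" by simp
  have "(250::nat) \<le> 2 ^ 498" by simp
  then have "250 \<le> card A" using N by (rule order_trans)
  then obtain m x C where L: "strict_mono_on {..m} x" "\<And>i. i \<le> m \<Longrightarrow> 0 < x i" "finite C" "C \<noteq> {}" "1 \<le> m" and le: "n \<le> 6 * real m" "real m \<le> 8 * real (card C)"
    "nprods m x C 16 \<le> real (card (prodset 16 A))"
    "npairs m x C 16 * n ^ 3
      \<le> 208 / 100 * real m ^ 3 * (real (card (sumset 16 A)) * real (card (prodset 16 A)))"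
    using log_chain_reduction[OF A] unfolding n_def by auto
  define p where "p = npairs m x C"
  define c where "c = nprods m x C"
  define u where "u = 6 * real m"
  have "(0::real) < 2 ^ 498" "(1::real) \<le> 2 ^ 498" by simp_all
  then have u: "u \<ge> n" "n \<ge> 1" "n > 0" "u > 0" "u \<ge> 1" "2 ^ 498 \<le> u"
    using n le(1) by (auto simp: u_def)
  have M: "0 \<le> M" "M \<le> n powr (3 / 2 + \<epsilon>)" using contra by (auto simp: M_def n_def \<epsilon>_def)
  have "p 16 * n ^ 3 \<le> 208 / 100 * real m ^ 3 * (real (card (sumset 16 A)) * real (card (prodset 16 A)))"
    unfolding p_def by (rule le(4))
  also have "\<dots> \<le> 208 / 100 * real m ^ 3 * (n powr (3 / 2 + \<epsilon>) * n powr (3 / 2 + \<epsilon>))"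
    using M by (intro mult_left_mono mult_mono) (auto simp: M_def)
  also have "n powr (3 / 2 + \<epsilon>) * n powr (3 / 2 + \<epsilon>) = n powr (2 * \<epsilon>) * n ^ 3"
  proof -
    have "n powr (3 / 2 + \<epsilon>) * n powr (3 / 2 + \<epsilon>) = n powr (2 * \<epsilon> + 3)"
      by (simp add: powr_add[symmetric] add.commute)
    also have "\<dots> = n powr (2 * \<epsilon>) * n powr 3" by (rule powr_add)
    finally show ?thesis using u by simp
  qed
  finally have "p 16 * n ^ 3 \<le> (208 / 100 * real m ^ 3 * n powr (2 * \<epsilon>)) * n ^ 3" by (simp add: mult.assoc)
  then have "p 16 \<le> 208 / 100 * real m ^ 3 * n powr (2 * \<epsilon>)"
    using u by (simp only: mult_le_cancel_right_pos zero_less_power)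
  also have "\<dots> \<le> 208 / 100 * real m ^ 3 * u powr (2 * \<epsilon>)"
    using u by (intro mult_left_mono powr_mono2) (auto simp: \<epsilon>_def)
  finally have p16: "p 16 \<le> 208 / 100 * real m ^ 3 * u powr (2 * \<epsilon>)" .
  have "c 16 \<le> M" using le(3) by (simp add: c_def M_def)
  also have "M \<le> u powr (3 / 2 + \<epsilon>)"
    using M(2) powr_mono2[of "3 / 2 + \<epsilon>" n u] u by (auto simp: \<epsilon>_def)
  finally have c16: "c 16 \<le> u powr (3 / 2 + \<epsilon>)" .
  define K :: real where "K = 9 ^ 15 * 64 * 96 ^ 11"
  define q where "q = 2 / 9 * real m ^ 3"
  have q: "q > 0" using L(5) by (simp add: q_def)
  have low: "q * u powr (- ((1/2) ^ j)) \<le> p (Suc j)" for j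
  proof -
    have "u powr (- ((1/2) ^ j)) \<le> (2 * real m) powr (- ((1/2) ^ j))"
      using L(5) by (intro powr_mono2') (auto simp: u_def)
    then have "q * u powr (- ((1/2) ^ j)) \<le> q * (2 * real m) powr (- ((1/2) ^ j))"
      using q by (intro mult_left_mono) auto
    also have "\<dots> \<le> p (Suc j)" unfolding q_def p_def by (rule npairs_lower_bound[OF L le(2)])
    finally show ?thesis .
  qed
  \<comment> \<open>The exponents are \<open>2 ^ 11 = 2048\<close> for index 12 and
    \<open>2 ^ 7 = 128\<close> for index 8. The total loss is
    \<open>26 / 2048 + 16 / 2048 = 42 / 2048\<close>.\<close>
  have low12: "q * u powr (- 1 / 2048) \<le> p 12" using low[of 11] by (simp add: power_divide)
  have low8: "q * u powr (- 1 / 128) \<le> p 8" using low[of 7] by (simp add: power_divide)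
  have pw: "(u powr s) ^ k = u powr (s * real k)" for s k
    using u by (simp add: powr_realpow[symmetric] powr_powr)
  have "2 ^ 15 * real m ^ 41 * ((q * u powr (- 1 / 2048)) ^ 26 * (q * u powr (- 1 / 128)))
      \<le> 2 ^ 15 * real m ^ 41 * (p 12 ^ 26 * p 8)"
    using low12 low8 q by (intro mult_left_mono mult_mono power_mono) auto
  also have "\<dots> \<le> K * (p 16 ^ 38 * c 16 ^ 5)"
    using growth_inequality[OF L] unfolding p_def[symmetric] c_def[symmetric] by (simp only: K_def mult.assoc)
  also have "\<dots> \<le> K * ((208 / 100 * real m ^ 3 * u powr (2 * \<epsilon>)) ^ 38 * (u powr (3 / 2 + \<epsilon>)) ^ 5)"
    using p16 c16 npairs_pos[OF L, of 16] nprods_ge_1[OF L, of 16] by (intro mult_left_mono mult_mono power_mono) (auto simp: K_def p_def c_def)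
  also have "\<dots> = K * (208 / 100) ^ 38 * real m ^ 114 * u powr (15 / 2 + 81 * \<epsilon>)"
    by (simp only: power_mult_distrib pw power_mult[symmetric] mult.assoc powr_add[symmetric])
      (simp add: algebra_simps)
  finally have main: "2 ^ 15 * real m ^ 41 * ((q * u powr (- 1 / 2048)) ^ 26 * (q * u powr (- 1 / 128)))
      \<le> K * (208 / 100) ^ 38 * real m ^ 114 * u powr (15 / 2 + 81 * \<epsilon>)" .
  have "(q * u powr (- 1 / 2048)) ^ 26 * (q * u powr (- 1 / 128)) = (2 / 9) ^ 27 * real m ^ 81 * u powr (- 42 / 2048)"
  proof -
    have "(q * u powr (- 1 / 2048)) ^ 26 * (q * u powr (- 1 / 128))
        = q ^ 26 * q * (u powr (- 1 / 2048 * real 26) * u powr (- 1 / 128))"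
      by (simp only: power_mult_distrib pw mult_ac)
    also have "u powr (- 1 / 2048 * real 26) * u powr (- 1 / 128) = u powr (- 42 / 2048)"
      by (simp add: powr_add[symmetric])
    also have "q ^ 26 * q = q ^ 27" by (simp flip: power_Suc2)
    also have "\<dots> = (2 / 9) ^ 27 * real m ^ 81" unfolding q_def power_mult_distrib by (simp flip: power_mult)
    finally show ?thesis .
  qed
  then have "real m ^ 114 * (2 ^ 15 * (2 / 9) ^ 27 * real m ^ 8 * u powr (- 42 / 2048))
      \<le> real m ^ 114 * (K * (208 / 100) ^ 38 * u powr (15 / 2 + 81 * \<epsilon>))"
    using main by (simp add: mult_ac flip: power_add)
  then have "2 ^ 15 * (2 / 9) ^ 27 * real m ^ 8 * u powr (- 42 / 2048)
      \<le> K * (208 / 100) ^ 38 * u powr (15 / 2 + 81 * \<epsilon>)"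
    using L(5) by (simp only: mult_le_cancel_left_pos zero_less_power of_nat_0_less_iff Suc_le_eq One_nat_def)
  \<comment> \<open>The value \<open>753 / 100\<close> is slightly above
    \<open>15 / 2 + 42 / 2048 + 81 * \<epsilon>\<close>, so the right-hand exponent becomes
    negative, while \<open>8 - 753 / 100 = 47 / 100\<close> remains on the left.\<close>
  then have "2 ^ 15 * (2 / 9) ^ 27 * real m ^ 8 * u powr (- 42 / 2048) * u powr (42 / 2048 - 753 / 100)
      \<le> K * (208 / 100) ^ 38 * u powr (15 / 2 + 81 * \<epsilon>) * u powr (42 / 2048 - 753 / 100)"
    by (intro mult_right_mono) auto
  also have "\<dots> = K * (208 / 100) ^ 38 * u powr (15 / 2 + 81 * \<epsilon> + (42 / 2048 - 753 / 100))"
    by (simp only: mult.assoc powr_add)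
  also have "\<dots> \<le> K * (208 / 100) ^ 38 * u powr 0"
    using u by (intro mult_left_mono powr_mono) (auto simp: K_def \<epsilon>_def)
  finally have bound: "2 ^ 15 * (2 / 9) ^ 27 * (real m ^ 8 * (u powr (- 42 / 2048) * u powr (42 / 2048 - 753 / 100))) \<le> K * (208 / 100) ^ 38"
    using u by (simp add: mult.assoc)
  have "real m ^ 8 * (u powr (- 42 / 2048) * u powr (42 / 2048 - 753 / 100)) = u powr (47 / 100) / 6 ^ 8"
  proof -
    have "real m ^ 8 = u powr 8 / 6 ^ 8"
      using u powr_realpow[of u 8] by (simp add: u_def power_mult_distrib)
    moreover have "u powr 8 * (u powr (- 42 / 2048) * u powr (42 / 2048 - 753 / 100)) = u powr (47 / 100)"
      unfolding powr_add[symmetric] by (rule arg_cong[of _ _ "(powr) u"]) simp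
    ultimately show ?thesis by (simp only: times_divide_eq_left)
  qed
  from bound[unfolded this] have "2 ^ 15 * (2 / 9) ^ 27 * (u powr (47 / 100) / 6 ^ 8) \<le> K * (208 / 100) ^ 38" .
  moreover have "2 ^ 234 \<le> u powr (47 / 100)"
  proof -
    have "(2::real) ^ 234 = 2 powr 234" using powr_realpow[of 2 234] by simp
    also have "\<dots> \<le> 2 powr (498 * (47 / 100))" by (intro powr_mono) auto
    also have "\<dots> = (2 powr real 498) powr (47 / 100)" unfolding powr_powr by simp
    also have "2 powr real 498 = (2::real) ^ 498" by (rule powr_realpow) simp
    also have "(2 ^ 498) powr (47 / 100) \<le> u powr (47 / 100)" using u by (intro powr_mono2) auto
    finally show ?thesis .
  qed
  then have "2 ^ 15 * (2 / 9) ^ 27 * (2 ^ 234 / 6 ^ 8) \<le> 2 ^ 15 * (2 / 9) ^ 27 * (u powr (47 / 100) / 6 ^ 8)"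
    by (intro mult_left_mono divide_right_mono) auto
  ultimately have "2 ^ 15 * (2 / 9) ^ 27 * (2 ^ 234 / 6 ^ 8) \<le> K * (208 / 100) ^ 38" by linarith
  then show False by (simp add: K_def power_divide)
qed

theorem theorem1p1:
  "\<exists>c::real. c > 0 \<and>
     (\<forall>A::real set. finite A \<longrightarrow>
        real (max (card (sumset 16 A)) (card (prodset 16 A))) \<ge> real (card A) powr (3 / 2 + c))"
proof -
  define B :: real where "B = 2 ^ 498"
  have "(1::real) < 2 ^ 498" by simp
  then have B: "B > 1" by (simp only: B_def)
  \<comment> \<open>The second term ensures \<open>B powr (2 * c) \<le> 1 + 1 / B ^ 3\<close>. Below
    \<open>B\<close> this turns the integer inequality \<open>n ^ 3 + 1 \<le> M ^ 2\<close> into a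
    gain in the exponent.\<close>
  define c where "c = min (1 / 10 ^ 6) (log B (1 + 1 / B ^ 3) / 2)"
  have "log B 1 < log B (1 + 1 / B ^ 3)" using B by (intro log_less) auto
  then have "log B (1 + 1 / B ^ 3) > 0" by simp
  then have c: "c > 0" by (simp add: c_def)
  show ?thesis
  proof (intro exI[of _ c] conjI c allI impI)
    fix A :: "real set" assume A: "finite A"
    define n where "n = real (card A)"
    define M where "M = max (card (sumset 16 A)) (card (prodset 16 A))"
    consider "card A = 0" | "card A = 1" | "2 \<le> card A" "card A < 2 ^ 498" | "2 ^ 498 \<le> card A" by linarith
    then have "n powr (3 / 2 + c) \<le> real M"
    proof cases
      case 2
      then obtain a where "A = {a}" by (auto simp: card_1_singleton_iff)
      then have "card (sumset 16 A) > 0" using sumset_nonempty[of A 16] A by (simp add: card_gt_0_iff)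
      then have "M \<ge> 1" by (simp add: M_def)
      then show ?thesis using 2 by (simp add: n_def)
    next
      case 3
      have "card A ^ 3 + 1 \<le> M ^ 2" using three_halves_strict[OF A 3] by (simp add: M_def)
      then have "real (card A ^ 3 + 1) \<le> real (M ^ 2)" by (simp only: of_nat_le_iff)
      then have M: "n ^ 3 + 1 \<le> real M ^ 2" by (simp add: n_def)
      have "real (card A) \<le> real (2 ^ 498)" using 3 by (simp only: of_nat_le_iff)
      then have n: "2 \<le> n" "n \<le> B" using 3 by (simp_all add: n_def B_def)
      have "n powr (2 * c) \<le> B powr (2 * c)" using n c by (intro powr_mono2) auto
      also have "\<dots> \<le> B powr (log B (1 + 1 / B ^ 3))" using B by (intro powr_mono) (auto simp: c_def)
      also have "\<dots> = 1 + 1 / B ^ 3" using B by (intro powr_log_cancel) (auto intro: add_pos_pos)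
      also have "\<dots> \<le> 1 + 1 / n ^ 3" using n by (intro add_left_mono divide_left_mono power_mono) auto
      finally have "n ^ 3 * n powr (2 * c) \<le> n ^ 3 * (1 + 1 / n ^ 3)" using n by (intro mult_left_mono) auto
      also have "\<dots> = n ^ 3 + 1" using n by (simp add: algebra_simps)
      also have "\<dots> \<le> real M ^ 2" by (rule M)
      also have "n ^ 3 * n powr (2 * c) = (n powr (3 / 2 + c)) ^ 2"
      proof -
        have "(n powr (3 / 2 + c)) ^ 2 = n powr (3 + 2 * c)"
          by (simp add: power2_eq_square powr_add[symmetric])
        also have "\<dots> = n powr 3 * n powr (2 * c)" by (rule powr_add)
        finally show ?thesis using n by simp
      qed
      finally show ?thesis by (rule power2_le_imp_le) simp
    next
      case 4
      have "(1::nat) \<le> 2 ^ 498" by simp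
      then have "1 \<le> card A" using 4 by (rule order_trans)
      then have "n powr (3 / 2 + c) \<le> n powr (3 / 2 + 1 / 10 ^ 6)"
        by (intro powr_mono) (auto simp: n_def c_def)
      also have "\<dots> \<le> real M" unfolding n_def M_def by (rule three_halves_plus[OF A 4])
      finally show ?thesis .
    \<comment> \<open>The empty set remains, where \<open>0 powr\<close> any exponent is 0.\<close>
    qed (simp add: n_def)
    then show "real (max (card (sumset 16 A)) (card (prodset 16 A))) \<ge> real (card A) powr (3 / 2 + c)"
      by (simp add: n_def M_def)
  qed
qed

end
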